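(* The wreath products $(\mathbb{Z}/4\mathbb{Z})\wr\mathbb{Z}$ and $(\mathbb{Z}/2\mathbb{Z}\times\mathbb{Z}/2\mathbb{Z})\wr\mathbb{Z}$ are not commensurable, but admit coarsely equivalent (actually isometric, for suitable choices of finite generating sets) box spaces.
   Context: Two groups are commensurable if they have isomorphic finite index subgroups. Here $F\wr\mathbb{Z}=\bigl(\bigoplus_{\mathbb{Z}}F\bigr)\rtimes\mathbb{Z}$ with $\mathbb{Z}$ acting by shift. A map $f:X\to Y$ of metric spaces is a coarse embedding if for all sequences $(x_n),(y_n)$ in $X$: $d_X(x_n,y_n)\to+\infty \iff d_Y(f(x_n),f(y_n))\to +\infty$. It is a coarse equivalence if moreover there is $R\ge 0$ such that $Y$ is the $R$-neighbourhood of $f(X)$. Box space: for a finitely generated residually finite group $G$ with a finite generating set $S$ and a filtration $(N_k)_{k>0}$ (a decreasing sequence of finite index normal subgroups with trivial intersection), $\square_{(N_k)}G$ is the disjoint union of the Cayley graphs of the $G/N_k$ with respect to the image of $S$, with a metric inducing the word metric on each component and with the distance between two different components at least the maximum of their diameters; it is well-defined up to coarse equivalence. *)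

theory Defs
  imports
    "HOL-Algebra.Elementary_Groups"
    "HOL-Algebra.Product_Groups"
    "HOL-Analysis.Abstract_Metric_Spaces"
begin

section \<open>Wreath products with the integers\<close>

definition semidirect_product ::
    "('a, 'c) monoid_scheme \<Rightarrow> ('b, 'd) monoid_scheme \<Rightarrow> ('b \<Rightarrow> 'a \<Rightarrow> 'a) \<Rightarrow> ('a \<times> 'b) monoid" where
  "semidirect_product A Q \<phi> =
     \<lparr>carrier = carrier A \<times> carrier Q,
      monoid.mult = (\<lambda>(a, g) (b, h). (a \<otimes>\<^bsub>A\<^esub> \<phi> g b, g \<otimes>\<^bsub>Q\<^esub> h)),
      one = (\<one>\<^bsub>A\<^esub>, \<one>\<^bsub>Q\<^esub>)\<rparr>"

definition wreath_int :: "('a, 'c) monoid_scheme \<Rightarrow> ((int \<Rightarrow> 'a) \<times> int) monoid" where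
  "wreath_int F =
     semidirect_product (sum_group UNIV (\<lambda>_. F)) integer_group (\<lambda>n x i. x (i - n))"


section \<open>Commensurability\<close>

definition finite_index_subgroup :: "'a set \<Rightarrow> ('a, 'c) monoid_scheme \<Rightarrow> bool" where
  "finite_index_subgroup A G \<longleftrightarrow> subgroup A G \<and> finite (rcosets\<^bsub>G\<^esub> A)"

definition commensurable :: "('a, 'c) monoid_scheme \<Rightarrow> ('b, 'd) monoid_scheme \<Rightarrow> bool" where
  "commensurable G H \<longleftrightarrow>
     (\<exists>A B. finite_index_subgroup A G \<and> finite_index_subgroup B H \<and>
            (G\<lparr>carrier := A\<rparr>) \<cong> (H\<lparr>carrier := B\<rparr>))"


section \<open>Coarse embeddings, coarse equivalences and isometries\<close>

definition coarse_embedding :: "'a metric \<Rightarrow> 'b metric \<Rightarrow> ('a \<Rightarrow> 'b) \<Rightarrow> bool" where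
  "coarse_embedding X Y f \<longleftrightarrow>
     f \<in> mspace X \<rightarrow> mspace Y \<and>
     (\<forall>x y :: nat \<Rightarrow> 'a. range x \<subseteq> mspace X \<longrightarrow> range y \<subseteq> mspace X \<longrightarrow>
        (filterlim (\<lambda>n. mdist X (x n) (y n)) at_top sequentially \<longleftrightarrow>
         filterlim (\<lambda>n. mdist Y (f (x n)) (f (y n))) at_top sequentially))"

definition coarse_equivalence :: "'a metric \<Rightarrow> 'b metric \<Rightarrow> ('a \<Rightarrow> 'b) \<Rightarrow> bool" where
  "coarse_equivalence X Y f \<longleftrightarrow>
     coarse_embedding X Y f \<and>
     (\<exists>R\<ge>0. \<forall>y\<in>mspace Y. \<exists>x\<in>mspace X. mdist Y y (f x) \<le> R)"

definition coarsely_equivalent :: "'a metric \<Rightarrow> 'b metric \<Rightarrow> bool" where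
  "coarsely_equivalent X Y \<longleftrightarrow> (\<exists>f. coarse_equivalence X Y f)"

definition isometric :: "'a metric \<Rightarrow> 'b metric \<Rightarrow> bool" where
  "isometric X Y \<longleftrightarrow>
     (\<exists>f. bij_betw f (mspace X) (mspace Y) \<and>
          (\<forall>x\<in>mspace X. \<forall>y\<in>mspace X. mdist Y (f x) (f y) = mdist X x y))"


section \<open>Cayley graphs and box spaces\<close>

definition finite_generating_set :: "('a, 'c) monoid_scheme \<Rightarrow> 'a set \<Rightarrow> bool" where
  "finite_generating_set G S \<longleftrightarrow> finite S \<and> S \<subseteq> carrier G \<and> generate G S = carrier G"

text \<open>The generating set need not be symmetric, so every edge is included in both directions.\<close>

definition cayley_edges :: "('a, 'c) monoid_scheme \<Rightarrow> 'a set \<Rightarrow> ('a \<times> 'a) set" where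
  "cayley_edges G S =
     {(x, y). x \<in> carrier G \<and> y \<in> carrier G \<and> (\<exists>s\<in>S. y = x \<otimes>\<^bsub>G\<^esub> s \<or> x = y \<otimes>\<^bsub>G\<^esub> s)}"

text \<open>
  The word metric is the path metric on the vertices of the Cayley graph.  When \<open>S\<close> generates
  \<open>G\<close>, any two elements are joined by a path, so the minimum below is over a nonempty set.
\<close>

definition word_dist :: "('a, 'c) monoid_scheme \<Rightarrow> 'a set \<Rightarrow> 'a \<Rightarrow> 'a \<Rightarrow> nat" where
  "word_dist G S x y = (LEAST n. (x, y) \<in> cayley_edges G S ^^ n)"

text \<open>Only used for finite groups; on an infinite carrier \<open>Max\<close> would be meaningless.\<close>

definition word_diameter :: "('a, 'c) monoid_scheme \<Rightarrow> 'a set \<Rightarrow> nat" where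
  "word_diameter G S = Max {word_dist G S x y | x y. x \<in> carrier G \<and> y \<in> carrier G}"

text \<open>
  The existence of a filtration makes \<open>G\<close> residually finite; \<open>N k \<lhd> G\<close> includes
  that \<open>G\<close> is a group.
\<close>

definition filtration :: "('a, 'c) monoid_scheme \<Rightarrow> (nat \<Rightarrow> 'a set) \<Rightarrow> bool" where
  "filtration G N \<longleftrightarrow>
     (\<forall>k. N k \<lhd> G \<and> finite_index_subgroup (N k) G) \<and>
     (\<forall>k. N (Suc k) \<subseteq> N k) \<and> (\<Inter>k. N k) = {\<one>\<^bsub>G\<^esub>}"

abbreviation image_in_quotient :: "('a, 'c) monoid_scheme \<Rightarrow> 'a set \<Rightarrow> 'a set \<Rightarrow> 'a set set" where
  "image_in_quotient G A S \<equiv> (\<lambda>s. A #>\<^bsub>G\<^esub> s) ` S"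

text \<open>
  \<open>box_space G S N X\<close>: the metric space \<open>X\<close> is a box space of \<open>G\<close> for the
  generating set \<open>S\<close> and the filtration \<open>N\<close>.  The metric between distinct components is
  only constrained from below, hence a predicate and not a function of \<open>G\<close>, \<open>S\<close>, \<open>N\<close>.
\<close>

definition box_space ::
    "('a, 'c) monoid_scheme \<Rightarrow> 'a set \<Rightarrow> (nat \<Rightarrow> 'a set) \<Rightarrow> (nat \<times> 'a set) metric \<Rightarrow> bool" where
  "box_space G S N X \<longleftrightarrow>
     finite_generating_set G S \<and> filtration G N \<and>
     mspace X = (SIGMA k:UNIV. carrier (G Mod N k)) \<and>
     (\<forall>k. \<forall>x\<in>carrier (G Mod N k). \<forall>y\<in>carrier (G Mod N k).
        mdist X (k, x) (k, y) = word_dist (G Mod N k) (image_in_quotient G (N k) S) x y) \<and>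
     (\<forall>j k. j \<noteq> k \<longrightarrow> (\<forall>x\<in>carrier (G Mod N j). \<forall>y\<in>carrier (G Mod N k).
        mdist X (j, x) (k, y) \<ge>
          max (word_diameter (G Mod N j) (image_in_quotient G (N j) S))
              (word_diameter (G Mod N k) (image_in_quotient G (N k) S))))"

end

theory Submission
  imports Defs "HOL-Algebra.Free_Abelian_Groups"
begin

text \<open>
  Write \<open>F = \<int>/4\<close> and \<open>F' = \<int>/2 \<times> \<int>/2\<close>.  By the pigeonhole principle, a finite index
  subgroup of \<open>F \<wr> \<int>\<close> contains the difference of two translates of the same lamp of order 4,
  hence an element of order 4.  Torsion elements of \<open>F' \<wr> \<int>\<close> are pure lamp configurations and
  have order at most 2, so no finite index subgroups are isomorphic.

  On the other hand, wrapping the line around a circle of length \<open>2^k\<close> defines a filtration of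
  either group with quotients \<open>F \<wr> \<int>/2^k\<close> and \<open>F' \<wr> \<int>/2^k\<close>.  For the generating set
  consisting of all states of the lamp at the origin and the unit step, an edge of the Cayley graph
  either changes one lamp arbitrarily or moves the lamplighter; this depends on \<open>F\<close> only as a set,
  so any bijection \<open>F \<rightarrow> F'\<close> induces isometries of the quotients.  Changing generating sets distorts
  the word metrics by a factor independent of \<open>k\<close>.  The distances between components need no control
  from above: since the diameters tend to infinity, only finitely many pairs of points in distinct
  components lie within a given distance.
\<close>

section \<open>Word metrics\<close>

lemma relpow_image:
  assumes "(x, y) \<in> R ^^ n" "\<And>u v. (u, v) \<in> R \<Longrightarrow> (f u, f v) \<in> R'"
  shows "(f x, f y) \<in> R' ^^ n"
  using assms(1)
proof (induction n arbitrary: y)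
  case (Suc n)
  then obtain z where "(x, z) \<in> R ^^ n" "(z, y) \<in> R"
    by (auto elim: relpow_Suc_E)
  then show ?case
    using Suc.IH assms(2) by (blast intro: relpow_Suc_I)
qed simp

lemma relpow_sym:
  assumes "sym R" "(x, y) \<in> R ^^ n"
  shows "(y, x) \<in> R ^^ n"
  using assms(2)
proof (induction n arbitrary: y)
  case (Suc n)
  then obtain z where "(x, z) \<in> R ^^ n" "(z, y) \<in> R"
    by (auto elim: relpow_Suc_E)
  then show ?case
    using Suc.IH symD[OF assms(1)] by (blast intro: relpow_Suc_I2)
qed simp

lemma sym_cayley_edges: "sym (cayley_edges G S)"
  by (auto simp: sym_def cayley_edges_def)

lemma cayley_edges_carrier:
  "(x, y) \<in> cayley_edges G S \<Longrightarrow> x \<in> carrier G \<and> y \<in> carrier G"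
  by (auto simp: cayley_edges_def)



text \<open>Edges are right multiplications by generators, so a homomorphism carries them to edges
  for the image generators. Applied to quotient maps, this lets paths descend.\<close>

lemma hom_cayley_path:
  assumes "h \<in> hom G H" "S \<subseteq> carrier G" "(x, y) \<in> cayley_edges G S ^^ n"
  shows "(h x, h y) \<in> cayley_edges H (h ` S) ^^ n"
  using assms(3)
proof (rule relpow_image)
  fix u v assume "(u, v) \<in> cayley_edges G S"
  then obtain s where s: "s \<in> S" "u \<in> carrier G" "v \<in> carrier G"
    "v = u \<otimes>\<^bsub>G\<^esub> s \<or> u = v \<otimes>\<^bsub>G\<^esub> s"
    by (auto simp: cayley_edges_def)
  then have "h v = h u \<otimes>\<^bsub>H\<^esub> h s \<or> h u = h v \<otimes>\<^bsub>H\<^esub> h s"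
    using assms(2) hom_mult[OF assms(1)] by blast
  with s show "(h u, h v) \<in> cayley_edges H (h ` S)"
    using hom_in_carrier[OF assms(1)] by (auto simp: cayley_edges_def)
qed

lemma word_dist_le: "(x, y) \<in> cayley_edges G S ^^ n \<Longrightarrow> word_dist G S x y \<le> n"
  unfolding word_dist_def by (rule Least_le)

lemma word_dist_commute: "word_dist G S x y = word_dist G S y x"
proof -
  have "(x, y) \<in> cayley_edges G S ^^ n \<longleftrightarrow> (y, x) \<in> cayley_edges G S ^^ n" for n
    by (blast intro: relpow_sym sym_cayley_edges)
  then show ?thesis
    by (simp add: word_dist_def)
qed

lemma word_dist_self [simp]: "word_dist G S x x = 0"
  using word_dist_le[where x = x and y = x and n = 0 and G = G and S = S] by simp

section \<open>Word metrics on groups: metric axioms, change of generators, growth\<close>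

context group
begin

text \<open>Generators multiply on the right, so left multiplication commutes with every
  step.\<close>

lemma cayley_path_translate:
  assumes "a \<in> carrier G" "S \<subseteq> carrier G" "(x, y) \<in> cayley_edges G S ^^ n"
  shows "(a \<otimes> x, a \<otimes> y) \<in> cayley_edges G S ^^ n"
  using assms(3)
proof (rule relpow_image)
  show "(a \<otimes> u, a \<otimes> v) \<in> cayley_edges G S" if "(u, v) \<in> cayley_edges G S" for u v
    using that assms(1,2) unfolding cayley_edges_def by (auto simp: m_assoc subset_iff)
qed

lemma cayley_path_exists:
  assumes S: "finite_generating_set G S" and x: "x \<in> carrier G" and y: "y \<in> carrier G"
  shows "\<exists>n. (x, y) \<in> cayley_edges G S ^^ n"
proof -
  have sub: "S \<subseteq> carrier G" and gen: "generate G S = carrier G"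
    using S by (auto simp: finite_generating_set_def)
  \<comment> \<open>The starting point is universally quantified within the induction: the path
    spelling \<open>h1 \<otimes> h2\<close> continues from \<open>x \<otimes> h1\<close>. The claim
    is finally used for the element \<open>inv x \<otimes> y\<close>.\<close>
  have "\<forall>x\<in>carrier G. \<exists>n. (x, x \<otimes> z) \<in> cayley_edges G S ^^ n" if "z \<in> generate G S" for z
    using that
  proof induction
    case one
    show ?case
      by (auto intro: exI[of _ 0])
  next
    case (incl h)
    then have "(x, x \<otimes> h) \<in> cayley_edges G S" if "x \<in> carrier G" for x
      using that sub by (auto simp: cayley_edges_def)
    then show ?case
      by (auto intro!: exI[of _ 1])
  next
    case (inv h)
    \<comment> \<open>The edge is traversed backwards, since multiplying
      \<open>x \<otimes> inv h\<close> by \<open>h\<close> gives \<open>x\<close>.\<close>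
    then have "(x, x \<otimes> inv h) \<in> cayley_edges G S" if "x \<in> carrier G" for x
      using that sub by (auto simp: cayley_edges_def m_assoc subset_iff intro!: bexI[of _ h])
    then show ?case
      by (auto intro!: exI[of _ 1])
  next
    case (eng h1 h2)
    show ?case
    proof
      fix x assume x: "x \<in> carrier G"
      have h: "h1 \<in> carrier G" "h2 \<in> carrier G"
        using eng(1,2) gen by auto
      obtain n m where "(x, x \<otimes> h1) \<in> cayley_edges G S ^^ n"
        "(x \<otimes> h1, x \<otimes> h1 \<otimes> h2) \<in> cayley_edges G S ^^ m"
        using eng x h by blast
      then show "\<exists>n. (x, x \<otimes> (h1 \<otimes> h2)) \<in> cayley_edges G S ^^ n"
        using x h by (metis relpow_trans m_assoc)
    qed
  qed
  moreover have "x \<otimes> (inv x \<otimes> y) = y"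
    using x y by (simp add: m_assoc[symmetric])
  ultimately show ?thesis
    using x y gen by (metis inv_closed m_closed)
qed

lemma word_dist_path:
  assumes "finite_generating_set G S" "x \<in> carrier G" "y \<in> carrier G"
  shows "(x, y) \<in> cayley_edges G S ^^ word_dist G S x y"
  unfolding word_dist_def by (rule LeastI_ex[OF cayley_path_exists[OF assms]])

lemma word_dist_eq_0_iff:
  assumes "finite_generating_set G S" "x \<in> carrier G" "y \<in> carrier G"
  shows "word_dist G S x y = 0 \<longleftrightarrow> x = y"
  using word_dist_path[OF assms] by auto

lemma word_dist_triangle:
  assumes "finite_generating_set G S" "x \<in> carrier G" "y \<in> carrier G" "z \<in> carrier G"
  shows "word_dist G S x z \<le> word_dist G S x y + word_dist G S y z"
  using assms by (blast intro: word_dist_le relpow_trans word_dist_path)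

text \<open>Each \<open>B\<close>-edge is replaced by a translate of an \<open>A\<close>-path from
  the identity to the generator, of length at most \<open>L\<close>. These bounds add up along a
  shortest \<open>B\<close>-path.\<close>

lemma word_dist_Lipschitz:
  assumes A: "finite_generating_set G A" and B: "finite_generating_set G B"
    and L: "\<And>b. b \<in> B \<Longrightarrow> word_dist G A \<one> b \<le> L"
    and x: "x \<in> carrier G" and y: "y \<in> carrier G"
  shows "word_dist G A x y \<le> L * word_dist G B x y"
proof -
  have sub: "A \<subseteq> carrier G" "B \<subseteq> carrier G"
    using A B by (auto simp: finite_generating_set_def)
  have step: "word_dist G A u (u \<otimes> b) \<le> L" if "u \<in> carrier G" "b \<in> B" for u b
  proof -
    have "(\<one>, b) \<in> cayley_edges G A ^^ word_dist G A \<one> b"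
      using word_dist_path[OF A] that sub by auto
    from cayley_path_translate[OF that(1) sub(1) this] that L[OF that(2)] show ?thesis
      using word_dist_le by (metis le_trans r_one)
  qed
  have edge: "word_dist G A u v \<le> L" if "(u, v) \<in> cayley_edges G B" for u v
    using that step word_dist_commute[of G A] by (auto simp: cayley_edges_def)
  have "word_dist G A x y \<le> L * n" if "(x, y) \<in> cayley_edges G B ^^ n" for n
    using that
  proof (induction n arbitrary: y)
    case (Suc n)
    then obtain z where z: "(x, z) \<in> cayley_edges G B ^^ n" "(z, y) \<in> cayley_edges G B"
      by (auto elim: relpow_Suc_E)
    have "word_dist G A x y \<le> word_dist G A x z + word_dist G A z y"
      using word_dist_triangle[OF A x] cayley_edges_carrier[OF z(2)] by blast
    then show ?case
      using Suc.IH[OF z(1)] edge[OF z(2)] by simp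
  qed simp
  then show ?thesis
    using word_dist_path[OF B x y] by blast
qed

text \<open>Every vertex has at most \<open>2 * card S\<close> neighbours: one for each generator
  and each orientation of its edge. The sets collect endpoints of walks with exactly
  \<open>n\<close> steps, so they need not increase with \<open>n\<close>.\<close>

lemma card_cayley_ball:
  assumes S: "finite S" "S \<subseteq> carrier G" and x: "x \<in> carrier G"
  shows "finite {y. (x, y) \<in> cayley_edges G S ^^ n}
         \<and> card {y. (x, y) \<in> cayley_edges G S ^^ n} \<le> (2 * card S) ^ n"
proof (induction n)
  case 0
  have "{y. (x, y) \<in> cayley_edges G S ^^ 0} = {x}"
    by auto
  then show ?case
    by simp
next
  case (Suc n)
  let ?B = "{y. (x, y) \<in> cayley_edges G S ^^ n}"
  \<comment> \<open>The Boolean records the orientation of the last edge.\<close>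
  let ?f = "\<lambda>(z, s, b). if b then z \<otimes> s else z \<otimes> inv s"
  have "{y. (x, y) \<in> cayley_edges G S ^^ Suc n} \<subseteq> ?f ` (?B \<times> S \<times> UNIV)"
  proof clarify
    fix y assume "(x, y) \<in> cayley_edges G S ^^ Suc n"
    then obtain z where z: "z \<in> ?B" "(z, y) \<in> cayley_edges G S"
      by (auto elim: relpow_Suc_E)
    then obtain s where s: "s \<in> S" "y = z \<otimes> s \<or> z = y \<otimes> s" "y \<in> carrier G" "z \<in> carrier G"
      by (auto simp: cayley_edges_def)
    then have "y = z \<otimes> s \<or> y = z \<otimes> inv s"
      using S by (auto simp: m_assoc)
    then have "y = ?f (z, s, y = z \<otimes> s)"
      by auto
    then show "y \<in> ?f ` (?B \<times> S \<times> UNIV)"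
      using z(1) s(1) by blast
  qed
  moreover have fin: "finite (?B \<times> S \<times> (UNIV :: bool set))"
    using Suc S by auto
  ultimately have "finite {y. (x, y) \<in> cayley_edges G S ^^ Suc n}"
    and "card {y. (x, y) \<in> cayley_edges G S ^^ Suc n} \<le> card (?B \<times> S \<times> (UNIV :: bool set))"
    by (auto intro: finite_surj surj_card_le)
  moreover have "card (?B \<times> S \<times> (UNIV :: bool set)) \<le> (2 * card S) ^ Suc n"
    using Suc by (simp add: card_cartesian_product mult.commute mult.left_commute)
  ultimately show ?case
    by linarith
qed

text \<open>Bounded diameter and a bounded number of generators bound the order of the group. Read
  backwards, growth of the quotients forces growth of their diameters.\<close>

lemma card_le_if_word_dist_le:
  assumes S: "finite_generating_set G S" and D: "\<And>y. y \<in> carrier G \<Longrightarrow> word_dist G S \<one> y \<le> D"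
  shows "card (carrier G) \<le> (\<Sum>n\<le>D. (2 * card S) ^ n)"
proof -
  let ?B = "\<lambda>n. {y. (\<one>, y) \<in> cayley_edges G S ^^ n}"
  have ball: "finite (?B n) \<and> card (?B n) \<le> (2 * card S) ^ n" for n
    using card_cayley_ball S by (auto simp: finite_generating_set_def)
  have "carrier G \<subseteq> (\<Union>n\<le>D. ?B n)"
    using word_dist_path[OF S one_closed] D by blast
  then have "card (carrier G) \<le> card (\<Union>n\<le>D. ?B n)"
    using ball by (intro card_mono) auto
  also have "\<dots> \<le> (\<Sum>n\<le>D. card (?B n))"
    by (rule card_UN_le) simp
  also have "\<dots> \<le> (\<Sum>n\<le>D. (2 * card S) ^ n)"
    using ball by (intro sum_mono) auto
  finally show ?thesis .
qed

end

section \<open>Word metrics on quotient groups\<close>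

lemma (in normal) word_dist_Mod_le:
  assumes S: "finite_generating_set G S" and x: "x \<in> carrier G" and y: "y \<in> carrier G"
  shows "word_dist (G Mod H) (image_in_quotient G H S) (H #> x) (H #> y) \<le> word_dist G S x y"
proof (rule word_dist_le)
  show "(H #> x, H #> y) \<in> cayley_edges (G Mod H) (image_in_quotient G H S) ^^ word_dist G S x y"
    using S by (intro hom_cayley_path[OF r_coset_hom_Mod] word_dist_path[OF S x y])
      (auto simp: finite_generating_set_def)
qed

lemma (in normal) finite_generating_set_Mod:
  assumes "finite_generating_set G S"
  shows "finite_generating_set (G Mod H) (image_in_quotient G H S)"
proof -
  interpret hom: group_hom G "G Mod H" "\<lambda>a. H #> a"
    by (simp add: group_hom_def group_hom_axioms_def factorgroup_is_group r_coset_hom_Mod is_group)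
  show ?thesis
    using assms hom.generate_img[of S]
    by (auto simp: finite_generating_set_def carrier_FactGroup)
qed

text \<open>The constant is found once in \<open>G\<close> and serves every quotient, because
  passing to a quotient cannot lengthen the generators in \<open>T\<close>. The sum over
  \<open>T\<close> is a convenient bound for the largest of their \<open>S\<close>-lengths.\<close>

lemma (in group) word_dist_Mod_Lipschitz:
  assumes S: "finite_generating_set G S" and T: "finite_generating_set G T"
  shows "\<exists>L. \<forall>N. N \<lhd> G \<longrightarrow> (\<forall>x\<in>carrier (G Mod N). \<forall>y\<in>carrier (G Mod N).
           word_dist (G Mod N) (image_in_quotient G N S) x y
             \<le> L * word_dist (G Mod N) (image_in_quotient G N T) x y)"
proof (intro exI allI impI ballI)
  let ?L = "\<Sum>t\<in>T. word_dist G S \<one> t"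
  fix N x y assume N: "N \<lhd> G" and xy: "x \<in> carrier (G Mod N)" "y \<in> carrier (G Mod N)"
  interpret N: normal N G by fact
  have T': "finite T" "T \<subseteq> carrier G"
    using T by (auto simp: finite_generating_set_def)
  show "word_dist (G Mod N) (image_in_quotient G N S) x y
          \<le> ?L * word_dist (G Mod N) (image_in_quotient G N T) x y"
  proof (rule group.word_dist_Lipschitz[OF N.factorgroup_is_group])
    fix b assume "b \<in> image_in_quotient G N T"
    then obtain t where t: "t \<in> T" "b = N #> t"
      by auto
    have "N #> \<one> = N"
      by (simp add: N.subset)
    then have "word_dist (G Mod N) (image_in_quotient G N S) \<one>\<^bsub>G Mod N\<^esub> b \<le> word_dist G S \<one> t"
      using N.word_dist_Mod_le[OF S one_closed, of t] t T' by auto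
    also have "\<dots> \<le> ?L"
      using T' t by (intro member_le_sum) auto
    finally show "word_dist (G Mod N) (image_in_quotient G N S) \<one>\<^bsub>G Mod N\<^esub> b \<le> ?L" .
  qed (use xy S T N.finite_generating_set_Mod in auto)
qed

section \<open>Isomorphisms of Cayley graphs\<close>

text \<open>Only unlabelled edges are compared and no compatibility with multiplication is asked, so
  that a mere bijection between lamp states can induce such a map.\<close>

definition cayley_iso ::
    "('a, 'c) monoid_scheme \<Rightarrow> 'a set \<Rightarrow> ('b, 'd) monoid_scheme \<Rightarrow> 'b set \<Rightarrow> ('a \<Rightarrow> 'b) \<Rightarrow> bool"
  where
  "cayley_iso G S H T f \<longleftrightarrow>
     bij_betw f (carrier G) (carrier H) \<and>
     (\<forall>x\<in>carrier G. \<forall>y\<in>carrier G.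
        (f x, f y) \<in> cayley_edges H T \<longleftrightarrow> (x, y) \<in> cayley_edges G S)"

lemma cayley_iso_comp:
  assumes "cayley_iso G S H T f" "cayley_iso H T K U g"
  shows "cayley_iso G S K U (g \<circ> f)"
  using assms bij_betw_trans[of f _ _ g] bij_betwE[of f "carrier G" "carrier H"]
  by (auto simp: cayley_iso_def)

lemma cayley_iso_inv:
  assumes "cayley_iso G S H T f"
  shows "cayley_iso H T G S (inv_into (carrier G) f)"
proof -
  let ?g = "inv_into (carrier G) f"
  have bij: "bij_betw f (carrier G) (carrier H)"
    using assms by (auto simp: cayley_iso_def)
  have g: "bij_betw ?g (carrier H) (carrier G)"
    using bij by (rule bij_betw_inv_into)
  have "(?g x, ?g y) \<in> cayley_edges G S \<longleftrightarrow> (x, y) \<in> cayley_edges H T"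
    if "x \<in> carrier H" "y \<in> carrier H" for x y
  proof -
    have "?g x \<in> carrier G" "?g y \<in> carrier G" "f (?g x) = x" "f (?g y) = y"
      using that bij_betwE[OF g] bij_betw_inv_into_right[OF bij] by auto
    then show ?thesis
      using assms unfolding cayley_iso_def by metis
  qed
  with g show ?thesis
    by (simp add: cayley_iso_def)
qed

lemma cayley_iso_group_iso:
  assumes h: "h \<in> iso G H" and S: "S \<subseteq> carrier G" and G: "group G"
  shows "cayley_iso G S H (h ` S) h"
proof -
  interpret group G by fact
  have inj: "inj_on h (carrier G)"
    using h by (auto simp: iso_def bij_betw_def)
  have "h y = h x \<otimes>\<^bsub>H\<^esub> h s \<longleftrightarrow> y = x \<otimes>\<^bsub>G\<^esub> s"
    if "x \<in> carrier G" "y \<in> carrier G" "s \<in> S" for x y s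
    using h that S inj_onD[OF inj, of y "x \<otimes>\<^bsub>G\<^esub> s"] by (auto simp: iso_def hom_mult subset_iff)
  then show ?thesis
    using h unfolding cayley_iso_def cayley_edges_def by (auto simp: iso_def hom_def)
qed

lemma cayley_iso_path:
  assumes f: "cayley_iso G S H T f" and "(x, y) \<in> cayley_edges G S ^^ n"
  shows "(f x, f y) \<in> cayley_edges H T ^^ n"
  using assms(2)
proof (rule relpow_image)
  show "(f u, f v) \<in> cayley_edges H T" if "(u, v) \<in> cayley_edges G S" for u v
    using f that cayley_edges_carrier[OF that] by (auto simp: cayley_iso_def)
qed

lemma cayley_iso_word_dist:
  assumes f: "cayley_iso G S H T f" and xy: "x \<in> carrier G" "y \<in> carrier G"
  shows "word_dist H T (f x) (f y) = word_dist G S x y"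
proof -
  let ?g = "inv_into (carrier G) f"
  have bij: "bij_betw f (carrier G) (carrier H)"
    using f by (auto simp: cayley_iso_def)
  have "(f x, f y) \<in> cayley_edges H T ^^ n \<longleftrightarrow> (x, y) \<in> cayley_edges G S ^^ n" for n
    using cayley_iso_path[OF f, of x y n]
      cayley_iso_path[OF cayley_iso_inv[OF f], of "f x" "f y" n]
      bij_betwE[OF bij] xy bij_betw_inv_into_left[OF bij]
    by auto
  then show ?thesis
    by (simp add: word_dist_def)
qed

section \<open>Box spaces\<close>

text \<open>Written as the image of a product, the set of distances is visibly finite for a finite
  group and can be transported along a bijection.\<close>

lemma word_diameter_image:
  "word_diameter G S = Max ((\<lambda>(x, y). word_dist G S x y) ` (carrier G \<times> carrier G))"
  unfolding word_diameter_def by (rule arg_cong[where f = Max]) auto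

lemma word_dist_le_diameter:
  assumes "finite (carrier G)" "x \<in> carrier G" "y \<in> carrier G"
  shows "word_dist G S x y \<le> word_diameter G S"
  unfolding word_diameter_image using assms by (intro Max_ge) auto

lemma cayley_iso_word_diameter:
  assumes f: "cayley_iso G S H T f"
  shows "word_diameter H T = word_diameter G S"
proof -
  have "carrier H \<times> carrier H = map_prod f f ` (carrier G \<times> carrier G)"
    using f by (simp add: cayley_iso_def bij_betw_def map_prod_surj_on)
  then have "(\<lambda>(x, y). word_dist H T x y) ` (carrier H \<times> carrier H)
      = (\<lambda>(x, y). word_dist G S x y) ` (carrier G \<times> carrier G)"
    using cayley_iso_word_dist[OF f] by (auto simp: image_image intro!: image_cong)
  then show ?thesis
    by (simp add: word_diameter_image)
qed

lemma filtration_finite_quotient: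
  "filtration G N \<Longrightarrow> finite (carrier (G Mod N k))"
  by (simp add: filtration_def finite_index_subgroup_def FactGroup_def)

section \<open>A concrete metric on the box space\<close>

text \<open>The sum of the two diameters dominates their maximum, as a box space requires, and
  satisfies the triangle inequality. The summand 1 separates components that are both single
  points.\<close>

definition box_dist ::
    "('a, 'c) monoid_scheme \<Rightarrow> 'a set \<Rightarrow> (nat \<Rightarrow> 'a set) \<Rightarrow> nat \<times> 'a set \<Rightarrow> nat \<times> 'a set \<Rightarrow> nat"
  where
  "box_dist G S N p q =
     (if fst p = fst q
      then word_dist (G Mod N (fst p)) (image_in_quotient G (N (fst p)) S) (snd p) (snd q)
      else word_diameter (G Mod N (fst p)) (image_in_quotient G (N (fst p)) S)
           + word_diameter (G Mod N (fst q)) (image_in_quotient G (N (fst q)) S) + 1)"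

definition box_metric ::
    "('a, 'c) monoid_scheme \<Rightarrow> 'a set \<Rightarrow> (nat \<Rightarrow> 'a set) \<Rightarrow> (nat \<times> 'a set) metric" where
  "box_metric G S N =
     metric (SIGMA k:UNIV. carrier (G Mod N k), \<lambda>p q. real (box_dist G S N p q))"

lemma box_dist_Metric_space:
  assumes S: "finite_generating_set G S" and N: "filtration G N"
  shows "Metric_space (SIGMA k:UNIV. carrier (G Mod N k)) (\<lambda>p q. real (box_dist G S N p q))"
proof
  have grp: "group (G Mod N k)"
    and gen: "finite_generating_set (G Mod N k) (image_in_quotient G (N k) S)" for k
  proof -
    interpret normal "N k" G
      using N by (simp add: filtration_def)
    show "group (G Mod N k)"
      by (rule factorgroup_is_group)
    show "finite_generating_set (G Mod N k) (image_in_quotient G (N k) S)"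
      by (rule finite_generating_set_Mod[OF S])
  qed
  note diam = word_dist_le_diameter[OF filtration_finite_quotient[OF N]]
  show "0 \<le> real (box_dist G S N p q)" for p q
    by simp
  show "real (box_dist G S N p q) = real (box_dist G S N q p)" for p q
    by (auto simp: box_dist_def word_dist_commute)
  show "real (box_dist G S N p q) = 0 \<longleftrightarrow> p = q"
    if "p \<in> (SIGMA k:UNIV. carrier (G Mod N k))" "q \<in> (SIGMA k:UNIV. carrier (G Mod N k))" for p q
    using that group.word_dist_eq_0_iff[OF grp gen] by (auto simp: box_dist_def)
  show "real (box_dist G S N p r) \<le> real (box_dist G S N p q) + real (box_dist G S N q r)"
    if mem: "p \<in> (SIGMA k:UNIV. carrier (G Mod N k))" "q \<in> (SIGMA k:UNIV. carrier (G Mod N k))"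
      "r \<in> (SIGMA k:UNIV. carrier (G Mod N k))" for p q r
  proof -
    obtain i x j y k z where pqr: "p = (i, x)" "q = (j, y)" "r = (k, z)"
      by (metis surj_pair)
    have xyz: "x \<in> carrier (G Mod N i)" "y \<in> carrier (G Mod N j)" "z \<in> carrier (G Mod N k)"
      using mem pqr by auto
    have "box_dist G S N p r \<le> box_dist G S N p q + box_dist G S N q r"
    proof (cases "i = k")
      \<comment> \<open>If \<open>q\<close> lies in another component, the distance from
        \<open>p\<close> to \<open>r\<close> is at most the diameter of their common component,
        which the detour through \<open>q\<close> exceeds.\<close>
      case True
      then show ?thesis
        using xyz diam[of x i z "image_in_quotient G (N i) S"]
          group.word_dist_triangle[OF grp gen, of x i y z]
        by (cases "j = k") (auto simp: pqr box_dist_def)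
    next
      case False
      then show ?thesis
        by (auto simp: pqr box_dist_def)
    qed
    then show ?thesis
      by linarith
  qed
qed

lemma mspace_box_metric:
  assumes "finite_generating_set G S" "filtration G N"
  shows "mspace (box_metric G S N) = (SIGMA k:UNIV. carrier (G Mod N k))"
  unfolding box_metric_def by (rule Metric_space.mspace_metric[OF box_dist_Metric_space[OF assms]])

lemma mdist_box_metric:
  assumes "finite_generating_set G S" "filtration G N"
  shows "mdist (box_metric G S N) p q = real (box_dist G S N p q)"
  unfolding box_metric_def by (simp add: Metric_space.mdist_metric[OF box_dist_Metric_space[OF assms]])

lemma box_space_box_metric:
  assumes "finite_generating_set G S" "filtration G N"
  shows "box_space G S N (box_metric G S N)"
  unfolding box_space_def using assms
  by (auto simp: mspace_box_metric[OF assms] mdist_box_metric[OF assms] box_dist_def)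

section \<open>Maps between box spaces acting on each component\<close>

abbreviation componentwise :: "(nat \<Rightarrow> 'a \<Rightarrow> 'b) \<Rightarrow> nat \<times> 'a \<Rightarrow> nat \<times> 'b" where
  "componentwise f \<equiv> \<lambda>p. (fst p, f (fst p) (snd p))"

lemma bij_betw_componentwise:
  assumes "\<And>k. bij_betw (f k) (A k) (B k)"
  shows "bij_betw (componentwise f) (SIGMA k:UNIV. A k) (SIGMA k:UNIV. B k)"
proof (rule bij_betw_byWitness)
  let ?g = "componentwise (\<lambda>k. inv_into (A k) (f k))"
  show "\<forall>p\<in>(SIGMA k:UNIV. A k). ?g (componentwise f p) = p"
    using bij_betw_inv_into_left[OF assms] by auto
  show "\<forall>p\<in>(SIGMA k:UNIV. B k). componentwise f (?g p) = p"
    using bij_betw_inv_into_right[OF assms] by auto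
  show "componentwise f ` (SIGMA k:UNIV. A k) \<subseteq> (SIGMA k:UNIV. B k)"
    using bij_betwE[OF assms] by auto
  show "?g ` (SIGMA k:UNIV. B k) \<subseteq> (SIGMA k:UNIV. A k)"
    using bij_betwE[OF bij_betw_inv_into[OF assms]] by auto
qed

text \<open>\<open>box_dist\<close> is computed from word distances and diameters of the components
  alone, and Cayley graph isomorphisms preserve both.\<close>

lemma isometric_box_metric:
  assumes S: "finite_generating_set G S" "filtration G M"
    and T: "finite_generating_set H T" "filtration H N"
    and f: "\<And>k. cayley_iso (G Mod M k) (image_in_quotient G (M k) S)
                            (H Mod N k) (image_in_quotient H (N k) T) (f k)"
  shows "isometric (box_metric G S M) (box_metric H T N)"
proof -
  have "bij_betw (componentwise f) (SIGMA k:UNIV. carrier (G Mod M k))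
          (SIGMA k:UNIV. carrier (H Mod N k))"
    using f by (intro bij_betw_componentwise) (simp add: cayley_iso_def)
  then show ?thesis
    unfolding isometric_def mspace_box_metric[OF S] mspace_box_metric[OF T]
    using cayley_iso_word_dist[OF f] cayley_iso_word_diameter[OF f]
    by (intro exI[of _ "componentwise f"])
      (auto simp: mdist_box_metric[OF S] mdist_box_metric[OF T] box_dist_def)
qed

section \<open>Coarse equivalence of box spaces\<close>

text \<open>A quotient of diameter at most \<open>D\<close> has order bounded in terms of
  \<open>D\<close> and \<open>card S\<close> only, and by \<open>growth\<close> few quotients are
  that small.\<close>

lemma finite_small_diameter:
  assumes S: "finite_generating_set G S" and M: "filtration G M"
    and growth: "\<And>B. finite {k. card (carrier (G Mod M k)) \<le> B}"
  shows "finite {k. word_diameter (G Mod M k) (image_in_quotient G (M k) S) \<le> D}"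
proof (rule finite_subset[OF _ growth])
  show "{k. word_diameter (G Mod M k) (image_in_quotient G (M k) S) \<le> D}
          \<subseteq> {k. card (carrier (G Mod M k)) \<le> (\<Sum>n\<le>D. (2 * card S) ^ n)}"
  proof clarify
    fix k assume D: "word_diameter (G Mod M k) (image_in_quotient G (M k) S) \<le> D"
    interpret normal "M k" G
      using M by (simp add: filtration_def)
    interpret Q: group "G Mod M k"
      by (rule factorgroup_is_group)
    have "word_dist (G Mod M k) (image_in_quotient G (M k) S) \<one>\<^bsub>G Mod M k\<^esub> y \<le> D"
      if "y \<in> carrier (G Mod M k)" for y
      using D word_dist_le_diameter[OF filtration_finite_quotient[OF M] Q.one_closed that]
      by (meson le_trans)
    then have "card (carrier (G Mod M k)) \<le> (\<Sum>n\<le>D. (2 * card (image_in_quotient G (M k) S)) ^ n)"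
      using Q.card_le_if_word_dist_le finite_generating_set_Mod[OF S] by blast
    also have "\<dots> \<le> (\<Sum>n\<le>D. (2 * card S) ^ n)"
      using S by (intro sum_mono power_mono mult_left_mono card_image_le)
        (auto simp: finite_generating_set_def)
    finally show "card (carrier (G Mod M k)) \<le> (\<Sum>n\<le>D. (2 * card S) ^ n)" .
  qed
qed

text \<open>Within a component the Lipschitz bound gives \<open>L * C\<close>. Two points of
  different components at distance at most \<open>C\<close> lie in components of diameter at most
  \<open>C\<close>; there are finitely many such pairs, so their image distances are bounded even
  though \<open>Y\<close> sets no upper limit on distances between components.\<close>

lemma box_space_map_controlled:
  assumes X: "box_space G S M X" and Y: "box_space H T N Y"
    and growth: "\<And>B. finite {k. card (carrier (G Mod M k)) \<le> B}"
    and f: "\<And>k x. x \<in> carrier (G Mod M k) \<Longrightarrow> f k x \<in> carrier (H Mod N k)"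
    and L: "\<And>k x y. x \<in> carrier (G Mod M k) \<Longrightarrow> y \<in> carrier (G Mod M k) \<Longrightarrow>
        word_dist (H Mod N k) (image_in_quotient H (N k) T) (f k x) (f k y)
          \<le> L * word_dist (G Mod M k) (image_in_quotient G (M k) S) x y"
  shows "\<exists>D. \<forall>p\<in>mspace X. \<forall>q\<in>mspace X. mdist X p q \<le> C \<longrightarrow>
           mdist Y (componentwise f p) (componentwise f q) \<le> D"
proof -
  have S: "finite_generating_set G S" "filtration G M"
    using X by (auto simp: box_space_def)
  let ?K = "{k. word_diameter (G Mod M k) (image_in_quotient G (M k) S) \<le> nat \<lceil>C\<rceil>}"
  let ?P = "SIGMA k:?K. carrier (G Mod M k)"
  define d where "d = (\<lambda>(p, q). mdist Y (componentwise f p) (componentwise f q))"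
  \<comment> \<open>Both summands are nonnegative when some pair is within distance
    \<open>C\<close>, so their sum covers both cases; summing over the finite set replaces taking a
    maximum.\<close>
  let ?D = "real L * C + sum d (?P \<times> ?P)"
  have fin: "finite ?P"
    using finite_small_diameter[OF S growth] filtration_finite_quotient[OF S(2)]
    by (rule finite_SigmaI)
  have d_nonneg: "0 \<le> d r" for r
    by (simp add: d_def split: prod.split)
  have sum_nonneg: "0 \<le> sum d (?P \<times> ?P)"
    by (intro sum_nonneg d_nonneg)
  have bound: "d (p, q) \<le> ?D" if p: "p \<in> mspace X" and q: "q \<in> mspace X" and C: "mdist X p q \<le> C" for p q
  proof -
    obtain j x k y where pq: "p = (j, x)" "q = (k, y)"
      by (metis surj_pair)
    have xy: "x \<in> carrier (G Mod M j)" "y \<in> carrier (G Mod M k)"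
      using p q X by (auto simp: pq box_space_def)
    have "0 \<le> C"
      using C mdist_nonneg[of X p q] by linarith
    show ?thesis
    proof (cases "j = k")
      case True
      have "d (p, q) = real (word_dist (H Mod N k) (image_in_quotient H (N k) T) (f k x) (f k y))"
        using Y f xy True by (simp add: pq d_def box_space_def)
      also have "\<dots> \<le> real L * real (word_dist (G Mod M k) (image_in_quotient G (M k) S) x y)"
        using L[of x k y] xy True by (metis of_nat_le_iff of_nat_mult)
      also have "real (word_dist (G Mod M k) (image_in_quotient G (M k) S) x y) = mdist X p q"
        using X xy True by (simp add: pq box_space_def)
      also have "real L * mdist X p q \<le> real L * C"
        using C by (intro mult_left_mono) auto
      finally show ?thesis
        using sum_nonneg by linarith
    next
      case False
      \<comment> \<open>The lower bound on distances between components puts both diameters below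
        \<open>C\<close>.\<close>
      then have "real (max (word_diameter (G Mod M j) (image_in_quotient G (M j) S))
                  (word_diameter (G Mod M k) (image_in_quotient G (M k) S))) \<le> C"
        using X xy C unfolding pq box_space_def by (meson order_trans)
      then have "j \<in> ?K" "k \<in> ?K"
        by (auto simp: le_nat_iff) linarith+
      then have "(p, q) \<in> ?P \<times> ?P"
        using xy by (auto simp: pq)
      then have "d (p, q) \<le> sum d (?P \<times> ?P)"
        by (rule member_le_sum) (use fin d_nonneg in auto)
      moreover have "0 \<le> real L * C"
        using \<open>0 \<le> C\<close> by simp
      ultimately show ?thesis
        by linarith
    qed
  qed
  show ?thesis
    by (intro exI[of _ ?D] ballI impI) (use bound in \<open>auto simp: d_def\<close>)
qed

lemma filterlim_at_top_controlled:
  fixes a b :: "nat \<Rightarrow> real"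
  assumes "filterlim a at_top sequentially" "\<And>C. \<exists>D. \<forall>n. b n \<le> C \<longrightarrow> a n \<le> D"
  shows "filterlim b at_top sequentially"
  unfolding filterlim_at_top
proof
  fix Z
  obtain D where D: "\<And>n. b n \<le> Z \<Longrightarrow> a n \<le> D"
    using assms(2) by blast
  have "eventually (\<lambda>n. D < a n) sequentially"
    using assms(1) by (simp add: filterlim_at_top_dense)
  then show "eventually (\<lambda>n. Z \<le> b n) sequentially"
    by eventually_elim (use D in \<open>meson not_le less_imp_le\<close>)
qed

text \<open>Each control is used by contraposition: bounding distances in \<open>Y\<close> by those
  in \<open>X\<close> shows that divergence in \<open>Y\<close> forces divergence in
  \<open>X\<close>, and conversely.\<close>

lemma coarse_embeddingI:
  assumes "f \<in> mspace X \<rightarrow> mspace Y"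
    and "\<And>C. \<exists>D. \<forall>p\<in>mspace X. \<forall>q\<in>mspace X. mdist X p q \<le> C \<longrightarrow> mdist Y (f p) (f q) \<le> D"
    and "\<And>C. \<exists>D. \<forall>p\<in>mspace X. \<forall>q\<in>mspace X. mdist Y (f p) (f q) \<le> C \<longrightarrow> mdist X p q \<le> D"
  shows "coarse_embedding X Y f"
  unfolding coarse_embedding_def
proof (intro conjI allI impI iffI)
  fix x y :: "nat \<Rightarrow> 'a" assume xy: "range x \<subseteq> mspace X" "range y \<subseteq> mspace X"
  show "filterlim (\<lambda>n. mdist Y (f (x n)) (f (y n))) at_top sequentially"
    if "filterlim (\<lambda>n. mdist X (x n) (y n)) at_top sequentially"
    using filterlim_at_top_controlled[OF that, of "\<lambda>n. mdist Y (f (x n)) (f (y n))"] assms(3) xy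
    by (meson range_subsetD)
  show "filterlim (\<lambda>n. mdist X (x n) (y n)) at_top sequentially"
    if "filterlim (\<lambda>n. mdist Y (f (x n)) (f (y n))) at_top sequentially"
    using filterlim_at_top_controlled[OF that, of "\<lambda>n. mdist X (x n) (y n)"] assms(2) xy
    by (meson range_subsetD)
qed (fact assms(1))

text \<open>Three changes of metric are composed: from \<open>S\<close> to \<open>S'\<close> in the
  source, through the isometry \<open>f k\<close>, and from \<open>T'\<close> to \<open>T\<close> in
  the target. The outer two cost constants that do not depend on \<open>k\<close>.\<close>

lemma box_space_iso_Lipschitz:
  assumes S: "finite_generating_set G S" and S': "finite_generating_set G S'"
    and M: "filtration G M"
    and T: "finite_generating_set H T" and T': "finite_generating_set H T'"
    and N: "filtration H N"
    and f: "\<And>k. cayley_iso (G Mod M k) (image_in_quotient G (M k) S')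
                            (H Mod N k) (image_in_quotient H (N k) T') (f k)"
  shows "\<exists>L. \<forall>k. \<forall>x\<in>carrier (G Mod M k). \<forall>y\<in>carrier (G Mod M k).
           word_dist (H Mod N k) (image_in_quotient H (N k) T) (f k x) (f k y)
             \<le> L * word_dist (G Mod M k) (image_in_quotient G (M k) S) x y"
proof -
  have "group G" "group H"
    using M N by (auto simp: filtration_def normal_def)
  obtain A where A: "\<And>U x y. U \<lhd> G \<Longrightarrow> x \<in> carrier (G Mod U) \<Longrightarrow> y \<in> carrier (G Mod U) \<Longrightarrow>
      word_dist (G Mod U) (image_in_quotient G U S') x y
        \<le> A * word_dist (G Mod U) (image_in_quotient G U S) x y"
    using group.word_dist_Mod_Lipschitz[OF \<open>group G\<close> S' S] by blast
  obtain B where B: "\<And>U x y. U \<lhd> H \<Longrightarrow> x \<in> carrier (H Mod U) \<Longrightarrow> y \<in> carrier (H Mod U) \<Longrightarrow>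
      word_dist (H Mod U) (image_in_quotient H U T) x y
        \<le> B * word_dist (H Mod U) (image_in_quotient H U T') x y"
    using group.word_dist_Mod_Lipschitz[OF \<open>group H\<close> T T'] by blast
  have "word_dist (H Mod N k) (image_in_quotient H (N k) T) (f k x) (f k y)
          \<le> B * A * word_dist (G Mod M k) (image_in_quotient G (M k) S) x y"
    if xy: "x \<in> carrier (G Mod M k)" "y \<in> carrier (G Mod M k)" for k x y
  proof -
    have fxy: "f k x \<in> carrier (H Mod N k)" "f k y \<in> carrier (H Mod N k)"
      using f[of k] xy by (auto simp: cayley_iso_def dest: bij_betwE)
    have "word_dist (H Mod N k) (image_in_quotient H (N k) T) (f k x) (f k y)
        \<le> B * word_dist (H Mod N k) (image_in_quotient H (N k) T') (f k x) (f k y)"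
      using N fxy by (intro B) (auto simp: filtration_def)
    also have "\<dots> = B * word_dist (G Mod M k) (image_in_quotient G (M k) S') x y"
      by (simp add: cayley_iso_word_dist[OF f xy])
    also have "\<dots> \<le> B * (A * word_dist (G Mod M k) (image_in_quotient G (M k) S) x y)"
      using M xy by (intro mult_left_mono A) (auto simp: filtration_def)
    finally show ?thesis
      by (simp add: mult.assoc)
  qed
  then show ?thesis
    by blast
qed

text \<open>The graph isomorphisms refer to the special generating sets \<open>S'\<close> and
  \<open>T'\<close>, while \<open>X\<close> and \<open>Y\<close> are built from arbitrary
  \<open>S\<close> and \<open>T\<close>. Control of \<open>f\<close> and of its inverse makes the
  componentwise map a coarse embedding.\<close>

theorem coarsely_equivalent_box_spaces:
  assumes X: "box_space G S M X" and Y: "box_space H T N Y"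
    and S': "finite_generating_set G S'" and T': "finite_generating_set H T'"
    and growth: "\<And>B. finite {k. card (carrier (G Mod M k)) \<le> B}"
    and f: "\<And>k. cayley_iso (G Mod M k) (image_in_quotient G (M k) S')
                            (H Mod N k) (image_in_quotient H (N k) T') (f k)"
  shows "coarsely_equivalent X Y"
proof -
  have S: "finite_generating_set G S" "filtration G M"
    and T: "finite_generating_set H T" "filtration H N"
    and XY: "mspace X = (SIGMA k:UNIV. carrier (G Mod M k))"
      "mspace Y = (SIGMA k:UNIV. carrier (H Mod N k))"
    using X Y by (auto simp: box_space_def)
  define g where "g k = inv_into (carrier (G Mod M k)) (f k)" for k
  have g: "cayley_iso (H Mod N k) (image_in_quotient H (N k) T')
                      (G Mod M k) (image_in_quotient G (M k) S') (g k)" for k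
    unfolding g_def by (rule cayley_iso_inv[OF f])
  have bij: "bij_betw (f k) (carrier (G Mod M k)) (carrier (H Mod N k))" for k
    using f by (simp add: cayley_iso_def)
  have "card (carrier (H Mod N k)) = card (carrier (G Mod M k))" for k
    using bij_betw_same_card[OF bij] by simp
  \<comment> \<open>This makes the control argument available for the inverse map as well.\<close>
  then have growth': "finite {k. card (carrier (H Mod N k)) \<le> B}" for B
    using growth by simp
  let ?F = "componentwise f" and ?G = "componentwise g"
  have F: "bij_betw ?F (mspace X) (mspace Y)"
    unfolding XY by (rule bij_betw_componentwise) (rule bij)
  obtain A where A: "\<And>k x y. x \<in> carrier (G Mod M k) \<Longrightarrow> y \<in> carrier (G Mod M k) \<Longrightarrow>
      word_dist (H Mod N k) (image_in_quotient H (N k) T) (f k x) (f k y)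
        \<le> A * word_dist (G Mod M k) (image_in_quotient G (M k) S) x y"
    using box_space_iso_Lipschitz[OF S(1) S' S(2) T(1) T' T(2) f] by blast
  obtain B where B: "\<And>k x y. x \<in> carrier (H Mod N k) \<Longrightarrow> y \<in> carrier (H Mod N k) \<Longrightarrow>
      word_dist (G Mod M k) (image_in_quotient G (M k) S) (g k x) (g k y)
        \<le> B * word_dist (H Mod N k) (image_in_quotient H (N k) T) x y"
    using box_space_iso_Lipschitz[OF T(1) T' T(2) S(1) S' S(2) g] by blast
  have "coarse_embedding X Y ?F"
  proof (rule coarse_embeddingI)
    show FXY: "?F \<in> mspace X \<rightarrow> mspace Y"
      using bij_betwE[OF F] by blast
    show "\<exists>D. \<forall>p\<in>mspace X. \<forall>q\<in>mspace X. mdist X p q \<le> C \<longrightarrow> mdist Y (?F p) (?F q) \<le> D" for C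
      using bij_betwE[OF bij] by (intro box_space_map_controlled[OF X Y growth _ A]) auto
    show "\<exists>D. \<forall>p\<in>mspace X. \<forall>q\<in>mspace X. mdist Y (?F p) (?F q) \<le> C \<longrightarrow> mdist X p q \<le> D" for C
    proof -
      have "\<exists>D. \<forall>p\<in>mspace Y. \<forall>q\<in>mspace Y. mdist Y p q \<le> C \<longrightarrow> mdist X (?G p) (?G q) \<le> D"
        using bij_betwE[OF bij_betw_inv_into[OF bij]]
        by (intro box_space_map_controlled[OF Y X growth' _ B]) (auto simp: g_def)
      then obtain D where D: "\<And>p q. p \<in> mspace Y \<Longrightarrow> q \<in> mspace Y \<Longrightarrow> mdist Y p q \<le> C \<Longrightarrow>
          mdist X (?G p) (?G q) \<le> D"
        by blast
      have GF: "?G (?F p) = p" if "p \<in> mspace X" for p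
        using that bij_betw_inv_into_left[OF bij] by (auto simp: XY g_def)
      have "mdist X p q \<le> D" if "p \<in> mspace X" "q \<in> mspace X" "mdist Y (?F p) (?F q) \<le> C" for p q
        using D[of "?F p" "?F q"] FXY GF that by (simp add: Pi_iff)
      then show ?thesis
        by blast
    qed
  qed
  \<comment> \<open>The map is onto, so the radius 0 suffices.\<close>
  moreover have "\<exists>x\<in>mspace X. mdist Y y (?F x) \<le> 0" if "y \<in> mspace Y" for y
  proof -
    have "y \<in> ?F ` mspace X"
      unfolding bij_betw_imp_surj_on[OF F] by (rule that)
    then obtain x where x: "y = ?F x" "x \<in> mspace X"
      by (rule imageE)
    have "mdist Y y (?F x) \<le> 0"
      using mdist_zero[OF that that] unfolding x(1)[symmetric] by (simp del: mdist_zero)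
    then show ?thesis
      using x(2) by (rule bexI)
  qed
  ultimately have "coarse_equivalence X Y ?F"
    unfolding coarse_equivalence_def by (intro conjI exI[of _ "0::real"]) auto
  then show ?thesis
    unfolding coarsely_equivalent_def by (rule exI[where x = ?F])
qed

section \<open>Lamplighter groups and their finite quotients\<close>

text \<open>
  The wreath product of \<open>F\<close> with \<open>\<int>/m\<close>; lamp configurations on the circle are encoded as
  \<open>m\<close>-periodic configurations on the line.
\<close>

definition circular_wreath :: "('a, 'c) monoid_scheme \<Rightarrow> int \<Rightarrow> ((int \<Rightarrow> 'a) \<times> int) monoid" where
  "circular_wreath F m =
     \<lparr>carrier = {u. (\<forall>i. u i \<in> carrier F) \<and> (\<forall>i. u (i mod m) = u i)} \<times> {0..<m},
      monoid.mult = (\<lambda>(u, k) (v, l). (\<lambda>i. u i \<otimes>\<^bsub>F\<^esub> v (i - k), (k + l) mod m)),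
      one = (\<lambda>_. \<one>\<^bsub>F\<^esub>, 0)\<rparr>"

text \<open>All lamps over one residue class are multiplied together. The class is infinite, so
  \<open>gfinprod\<close> is used, which takes the product over the support.\<close>

definition wind :: "('a, 'c) monoid_scheme \<Rightarrow> int \<Rightarrow> (int \<Rightarrow> 'a) \<times> int \<Rightarrow> (int \<Rightarrow> 'a) \<times> int" where
  "wind F m = (\<lambda>(x, n). (\<lambda>r. gfinprod F x {i. i mod m = r mod m}, n mod m))"

text \<open>The lengths are powers of 2 so that each circle is covered by the next one, which makes
  the kernels decrease.\<close>

definition wind_kernel :: "('a, 'c) monoid_scheme \<Rightarrow> nat \<Rightarrow> ((int \<Rightarrow> 'a) \<times> int) set" where
  "wind_kernel F k = kernel (wreath_int F) (circular_wreath F (2 ^ k)) (wind F (2 ^ k))"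

definition lamp :: "('a, 'c) monoid_scheme \<Rightarrow> int \<Rightarrow> 'a \<Rightarrow> int \<Rightarrow> 'a" where
  "lamp F j f = (\<lambda>i. if i = j then f else \<one>\<^bsub>F\<^esub>)"

text \<open>With every lamp state among the generators, one edge can bring the current lamp into any
  state. The identity of \<open>F\<close> contributes loops only.\<close>

definition lamplighter_gens :: "('a, 'c) monoid_scheme \<Rightarrow> ((int \<Rightarrow> 'a) \<times> int) set" where
  "lamplighter_gens F = (\<lambda>f. (lamp F 0 f, 0)) ` carrier F \<union> {(\<lambda>_. \<one>\<^bsub>F\<^esub>, 1)}"

section \<open>Wreath products in coordinates\<close>

lemma mult_wreath_int:
  "(x, n) \<otimes>\<^bsub>wreath_int F\<^esub> (y, m) = (\<lambda>i. x i \<otimes>\<^bsub>F\<^esub> y (i - n), n + m)"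
  by (simp add: wreath_int_def semidirect_product_def integer_group_def restrict_UNIV)

lemma one_wreath_int: "\<one>\<^bsub>wreath_int F\<^esub> = (\<lambda>_. \<one>\<^bsub>F\<^esub>, 0)"
  by (simp add: wreath_int_def semidirect_product_def integer_group_def restrict_UNIV)

lemma mult_circular_wreath:
  "(u, k) \<otimes>\<^bsub>circular_wreath F m\<^esub> (v, l) = (\<lambda>i. u i \<otimes>\<^bsub>F\<^esub> v (i - k), (k + l) mod m)"
  by (simp add: circular_wreath_def)

lemma one_circular_wreath: "\<one>\<^bsub>circular_wreath F m\<^esub> = (\<lambda>_. \<one>\<^bsub>F\<^esub>, 0)"
  by (simp add: circular_wreath_def)

lemma carrier_circular_wreath:
  "(u, k) \<in> carrier (circular_wreath F m) \<longleftrightarrow>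
     (\<forall>i. u i \<in> carrier F) \<and> (\<forall>i. u (i mod m) = u i) \<and> 0 \<le> k \<and> k < m"
  by (auto simp: circular_wreath_def)

lemma periodic_cong:
  fixes u :: "int \<Rightarrow> 'a"
  assumes "\<forall>i. u (i mod m) = u i" "a mod m = b mod m"
  shows "u a = u b"
  using assms by metis

section \<open>Products of finitely supported families\<close>

lemma (in comm_monoid) gfinprod_singular:
  assumes "j \<in> A" "f j \<in> carrier G" "\<And>i. i \<in> A \<Longrightarrow> i \<noteq> j \<Longrightarrow> f i = \<one>"
  shows "gfinprod G f A = f j"
proof -
  have "gfinprod G f A = gfinprod G f {j}"
    by (rule gfinprod_mono_neutral_cong_right) (use assms in \<open>auto, metis one_closed\<close>)
  then show ?thesis
    using assms(2) by simp
qed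

lemma (in comm_monoid) gfinprod_all_one:
  assumes "\<And>i. i \<in> A \<Longrightarrow> f i = \<one>"
  shows "gfinprod G f A = \<one>"
proof -
  have "gfinprod G f A = gfinprod G f {}"
    by (rule gfinprod_mono_neutral_cong_right) (use assms in auto)
  then show ?thesis
    by simp
qed

lemma (in comm_monoid) gfinprod_Un_disjoint:
  assumes "finite {i \<in> A \<union> B. f i \<noteq> \<one>}" "A \<inter> B = {}" "f \<in> A \<union> B \<rightarrow> carrier G"
  shows "gfinprod G f (A \<union> B) = gfinprod G f A \<otimes> gfinprod G f B"
proof -
  have "{i \<in> A \<union> B. f i \<noteq> \<one>} = {i \<in> A. f i \<noteq> \<one>} \<union> {i \<in> B. f i \<noteq> \<one>}"
    by auto
  moreover from this assms(1) have "finite {i \<in> A. f i \<noteq> \<one>}" "finite {i \<in> B. f i \<noteq> \<one>}"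
    by auto
  ultimately show ?thesis
    using assms(2,3) unfolding gfinprod_def
    by (auto intro!: finprod_Un_disjoint)
qed

text \<open>The two supports correspond under \<open>h\<close>, so they are finite together; if they
  are infinite, both sides are the default value \<open>\<one>\<close>.\<close>

lemma (in comm_monoid) gfinprod_reindex:
  assumes "inj_on h A" "f \<in> h ` A \<rightarrow> carrier G"
  shows "gfinprod G f (h ` A) = gfinprod G (\<lambda>i. f (h i)) A"
proof -
  have "{x \<in> h ` A. f x \<noteq> \<one>} = h ` {i \<in> A. f (h i) \<noteq> \<one>}"
    by auto
  moreover have inj: "inj_on h {i \<in> A. f (h i) \<noteq> \<one>}"
    using assms(1) by (auto simp: inj_on_def)
  moreover have "finprod G f (h ` {i \<in> A. f (h i) \<noteq> \<one>})
      = finprod G (\<lambda>i. f (h i)) {i \<in> A. f (h i) \<noteq> \<one>}"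
    using assms(2) by (intro finprod_reindex inj) auto
  ultimately show ?thesis
    by (simp add: gfinprod_def finite_image_iff)
qed

section \<open>Group structure and size of the wreath products\<close>

text \<open>Commutativity makes winding a homomorphism; finiteness gives finitely many generators
  and finite quotients.\<close>

locale lamp_group = comm_group F for F (structure) +
  assumes finite_lamps: "finite (carrier F)"
begin

lemma carrier_wreath_int:
  "(x, n) \<in> carrier (wreath_int F) \<longleftrightarrow> (\<forall>i. x i \<in> carrier F) \<and> finite {i. x i \<noteq> \<one>}"
  by (auto simp: wreath_int_def semidirect_product_def integer_group_def carrier_sum_group
      is_group)

lemma finite_support_shift:
  fixes y :: "int \<Rightarrow> 'a"
  assumes "finite {i. y i \<noteq> \<one>}"
  shows "finite {i. y (i - n) \<noteq> \<one>}"
proof -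
  have "{i. y (i - n) \<noteq> \<one>} = (\<lambda>i. i - n) -` {i. y i \<noteq> \<one>}"
    by auto
  then show ?thesis
    using finite_vimageI[OF assms, of "\<lambda>i. i - n"] by (simp add: inj_on_def)
qed

lemma group_wreath_int: "group (wreath_int F)"
proof (rule groupI; (clarsimp simp: one_wreath_int mult_wreath_int carrier_wreath_int)?)
  fix x y :: "int \<Rightarrow> 'a" and n :: int
  assume "finite {i. x i \<noteq> \<one>}" "finite {i. y i \<noteq> \<one>}"
  from finite_UnI[OF this(1) finite_support_shift[OF this(2), of n]]
  show "finite {i. x i \<otimes> y (i - n) \<noteq> \<one>}"
    by (rule finite_subset[rotated]) auto
next
  fix x y z :: "int \<Rightarrow> 'a" and n m :: int
  assume "\<forall>i. x i \<in> carrier F" "\<forall>i. y i \<in> carrier F" "\<forall>i. z i \<in> carrier F"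
  then show "(\<lambda>i. x i \<otimes> y (i - n) \<otimes> z (i - (n + m)))
      = (\<lambda>i. x i \<otimes> (y (i - n) \<otimes> z (i - n - m)))"
    by (simp add: m_assoc algebra_simps)
next
  fix x :: "int \<Rightarrow> 'a" and n :: int
  assume x: "\<forall>i. x i \<in> carrier F" "finite {i. x i \<noteq> \<one>}"
  \<comment> \<open>The inverse walks back by \<open>n\<close>, so the lamps to be cancelled are
    seen shifted by \<open>n\<close>.\<close>
  have "(\<lambda>i. inv (x (i + n)), - n) \<in> carrier (wreath_int F)"
    using x finite_support_shift[OF x(2), of "- n"]
    by (simp add: carrier_wreath_int inv_eq_1_iff)
  moreover have "(\<lambda>i. inv (x (i + n)), - n) \<otimes>\<^bsub>wreath_int F\<^esub> (x, n) = (\<lambda>_. \<one>, 0)"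
    using x by (simp add: mult_wreath_int)
  ultimately show "\<exists>y\<in>carrier (wreath_int F). y \<otimes>\<^bsub>wreath_int F\<^esub> (x, n) = (\<lambda>_. \<one>, 0)"
    by blast
qed

lemma group_circular_wreath:
  assumes "m > 0"
  shows "group (circular_wreath F m)"
proof (rule groupI)
  fix p q assume "p \<in> carrier (circular_wreath F m)" "q \<in> carrier (circular_wreath F m)"
  then obtain u k v l where pq: "p = (u, k)" "q = (v, l)"
    and u: "\<forall>i. u i \<in> carrier F" "\<forall>i. u (i mod m) = u i"
    and v: "\<forall>i. v i \<in> carrier F" "\<forall>i. v (i mod m) = v i"
    by (metis carrier_circular_wreath surj_pair)
  \<comment> \<open>Here and below, periodicity allows an argument or a shift to be reduced modulo
    \<open>m\<close>.\<close>
  have "v (i mod m - k) = v (i - k)" for i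
    by (rule periodic_cong[OF v(2)]) (simp add: mod_diff_left_eq)
  then show "p \<otimes>\<^bsub>circular_wreath F m\<^esub> q \<in> carrier (circular_wreath F m)"
    using u v \<open>m > 0\<close> by (simp add: pq mult_circular_wreath carrier_circular_wreath)
  fix r assume "r \<in> carrier (circular_wreath F m)"
  then obtain w j where r: "r = (w, j)"
    and w: "\<forall>i. w i \<in> carrier F" "\<forall>i. w (i mod m) = w i"
    by (metis carrier_circular_wreath surj_pair)
  have "w (i - (k + l) mod m) = w (i - k - l)" for i
    by (rule periodic_cong[OF w(2)]) (simp add: mod_diff_right_eq algebra_simps)
  then show "p \<otimes>\<^bsub>circular_wreath F m\<^esub> q \<otimes>\<^bsub>circular_wreath F m\<^esub> r
      = p \<otimes>\<^bsub>circular_wreath F m\<^esub> (q \<otimes>\<^bsub>circular_wreath F m\<^esub> r)"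
    using u v w
    by (simp add: pq r mult_circular_wreath m_assoc mod_add_left_eq mod_add_right_eq add.assoc)
next
  show "\<one>\<^bsub>circular_wreath F m\<^esub> \<in> carrier (circular_wreath F m)"
    using \<open>m > 0\<close> by (simp add: one_circular_wreath carrier_circular_wreath)
next
  fix p assume "p \<in> carrier (circular_wreath F m)"
  then obtain u k where p: "p = (u, k)"
    and u: "\<forall>i. u i \<in> carrier F" "\<forall>i. u (i mod m) = u i" and k: "0 \<le> k" "k < m"
    by (metis carrier_circular_wreath surj_pair)
  then show "\<one>\<^bsub>circular_wreath F m\<^esub> \<otimes>\<^bsub>circular_wreath F m\<^esub> p = p"
    by (simp add: one_circular_wreath mult_circular_wreath)
  have "u (i mod m + k) = u (i + k)" for i
    by (rule periodic_cong[OF u(2)]) (simp add: mod_add_left_eq)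
  moreover have "u (i - (- k) mod m) = u (i + k)" for i
    using mod_diff_right_eq[of i "- k" m] by (intro periodic_cong[OF u(2)]) simp
  ultimately have "(\<lambda>i. inv (u (i + k)), (- k) mod m) \<in> carrier (circular_wreath F m)"
    "(\<lambda>i. inv (u (i + k)), (- k) mod m) \<otimes>\<^bsub>circular_wreath F m\<^esub> p = \<one>\<^bsub>circular_wreath F m\<^esub>"
    using u \<open>m > 0\<close>
    by (simp_all add: p carrier_circular_wreath mult_circular_wreath one_circular_wreath
        mod_add_left_eq)
  then show "\<exists>q\<in>carrier (circular_wreath F m).
      q \<otimes>\<^bsub>circular_wreath F m\<^esub> p = \<one>\<^bsub>circular_wreath F m\<^esub>"
    by blast
qed

text \<open>A periodic configuration is determined by its restriction to one period.\<close>

lemma finite_circular_wreath: "finite (carrier (circular_wreath F m))"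
proof -
  let ?U = "{u. (\<forall>i. u i \<in> carrier F) \<and> (\<forall>i. u (i mod m) = u i)}"
  show ?thesis
  proof (cases "m > 0")
    case True
    have "inj_on (\<lambda>u. restrict u {0..<m}) ?U"
    proof (rule inj_onI)
      fix u v assume uv: "u \<in> ?U" "v \<in> ?U" "restrict u {0..<m} = restrict v {0..<m}"
      have "u (i mod m) = v (i mod m)" for i
        using fun_cong[OF uv(3), of "i mod m"] True by simp
      then show "u = v"
        using uv(1,2) by (simp add: fun_eq_iff)
    qed
    moreover have "(\<lambda>u. restrict u {0..<m}) ` ?U \<subseteq> (\<Pi>\<^sub>E i\<in>{0..<m}. carrier F)"
      by auto
    moreover have "finite (\<Pi>\<^sub>E i\<in>{0..<m}. carrier F)"
      by (intro finite_PiE finite_lamps) auto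
    ultimately have "finite ?U"
      by (meson finite_imageD finite_subset)
    then show ?thesis
      by (simp add: circular_wreath_def)
  qed (simp add: circular_wreath_def)
qed

text \<open>The \<open>m\<close> positions of the lamplighter with all lamps off already give this
  bound.\<close>

lemma card_circular_wreath: "nat m \<le> card (carrier (circular_wreath F m))"
proof -
  have "{\<lambda>_. \<one>} \<times> {0..<m} \<subseteq> carrier (circular_wreath F m)"
    by (auto simp: circular_wreath_def)
  from card_mono[OF finite_circular_wreath this] show ?thesis
    by (simp add: card_cartesian_product)
qed

section \<open>The winding homomorphism\<close>

lemma wind_hom:
  assumes "m > 0"
  shows "wind F m \<in> hom (wreath_int F) (circular_wreath F m)"
proof (rule homI)
  fix p assume "p \<in> carrier (wreath_int F)"
  then show "wind F m p \<in> carrier (circular_wreath F m)"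
    using assms by (cases p) (simp add: carrier_wreath_int wind_def carrier_circular_wreath)
next
  fix p q assume "p \<in> carrier (wreath_int F)" "q \<in> carrier (wreath_int F)"
  then obtain x n y l where pq: "p = (x, n)" "q = (y, l)"
    and x: "\<forall>i. x i \<in> carrier F" "finite {i. x i \<noteq> \<one>}"
    and y: "\<forall>i. y i \<in> carrier F" "finite {i. y i \<noteq> \<one>}"
    by (metis carrier_wreath_int surj_pair)
  have fin: "finite {i \<in> A. x i \<noteq> \<one>}" "finite {i \<in> A. y (i - n) \<noteq> \<one>}" for A
    using x(2) finite_support_shift[OF y(2), of n] by auto
  \<comment> \<open>Shifting by \<open>n\<close> maps the residue class of \<open>r\<close> onto
    that of \<open>r - n\<close>, which turns a shift on the line into a shift on the
    circle.\<close>
  have "gfinprod F (\<lambda>i. y (i - n)) {i. i mod m = r mod m}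
      = gfinprod F y {i. i mod m = (r - n mod m) mod m}" for r
  proof -
    have "{i. i mod m = (r - n mod m) mod m} = (\<lambda>i. i - n) ` {i. i mod m = r mod m}" (is "?A = ?B")
    proof
      show "?B \<subseteq> ?A"
        by (auto simp: mod_diff_right_eq) (metis mod_diff_left_eq)
      show "?A \<subseteq> ?B"
      proof
        fix i assume "i \<in> ?A"
        then have "(i + n) mod m = r mod m"
          by (simp add: mod_diff_right_eq) (metis diff_add_cancel mod_add_left_eq)
        then show "i \<in> ?B"
          by (intro image_eqI[of _ _ "i + n"]) auto
      qed
    qed
    then show ?thesis
      using y(1) by (simp add: gfinprod_reindex inj_on_def)
  qed
  then have "gfinprod F (\<lambda>i. x i \<otimes> y (i - n)) {i. i mod m = r mod m}
      = gfinprod F x {i. i mod m = r mod m} \<otimes> gfinprod F y {i. i mod m = (r - n mod m) mod m}" for r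
    using gfinprod_distrib[OF fin] x y by simp
  then show "wind F m (p \<otimes>\<^bsub>wreath_int F\<^esub> q)
      = wind F m p \<otimes>\<^bsub>circular_wreath F m\<^esub> wind F m q"
    by (simp add: pq wind_def mult_wreath_int mult_circular_wreath mod_add_eq)
qed

text \<open>A periodic configuration is lifted by keeping the lamps of one period and switching off
  all others.\<close>

lemma wind_surj:
  assumes "m > 0"
  shows "wind F m ` carrier (wreath_int F) = carrier (circular_wreath F m)"
proof
  show "wind F m ` carrier (wreath_int F) \<subseteq> carrier (circular_wreath F m)"
    using wind_hom[OF assms] by (auto simp: hom_def)
  show "carrier (circular_wreath F m) \<subseteq> wind F m ` carrier (wreath_int F)"
  proof clarify
    fix u k assume uk: "(u, k) \<in> carrier (circular_wreath F m)"
    define x where "x = (\<lambda>i. if i \<in> {0..<m} then u i else \<one>)"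
    have "finite {i. x i \<noteq> \<one>}"
      by (rule finite_subset[of _ "{0..<m}"]) (auto simp: x_def)
    then have "(x, k) \<in> carrier (wreath_int F)"
      using uk by (auto simp: carrier_wreath_int carrier_circular_wreath x_def)
    \<comment> \<open>Each residue class meets the period \<open>{0..<m}\<close> in the single point
      \<open>r mod m\<close>.\<close>
    moreover have "gfinprod F x {i. i mod m = r mod m} = x (r mod m)" for r
      using uk assms by (intro gfinprod_singular) (auto simp: x_def carrier_circular_wreath)
    then have "wind F m (x, k) = (u, k)"
      using uk assms by (auto simp: wind_def x_def carrier_circular_wreath)
    ultimately show "(u, k) \<in> wind F m ` carrier (wreath_int F)"
      by (metis image_eqI)
  qed
qed

lemma wind_group_hom: "m > 0 \<Longrightarrow> group_hom (wreath_int F) (circular_wreath F m) (wind F m)"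
  by (simp add: group_hom_def group_hom_axioms_def group_wreath_int group_circular_wreath wind_hom)

lemma wind_kernel_normal: "wind_kernel F k \<lhd> wreath_int F"
  unfolding wind_kernel_def by (intro group_hom.normal_kernel wind_group_hom) simp

text \<open>This is the first isomorphism theorem; \<open>the_elem\<close> extracts the common value
  of \<open>wind\<close> on a coset.\<close>

lemma wind_kernel_iso:
  "(\<lambda>X. the_elem (wind F (2 ^ k) ` X))
     \<in> iso (wreath_int F Mod wind_kernel F k) (circular_wreath F (2 ^ k))"
  unfolding wind_kernel_def by (intro group_hom.FactGroup_iso_set wind_group_hom wind_surj) simp_all

lemma card_wind_quotient:
  "card (carrier (wreath_int F Mod wind_kernel F k)) = card (carrier (circular_wreath F (2 ^ k)))"
  using wind_kernel_iso[of k] by (auto simp: iso_def dest: bij_betw_same_card)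

lemma finite_wind_quotient: "finite (carrier (wreath_int F Mod wind_kernel F k))"
  using wind_kernel_iso[of k] finite_circular_wreath[of "2 ^ k"]
  by (auto simp: iso_def dest: bij_betw_finite)

lemma wind_quotient_growth:
  "finite {k. card (carrier (wreath_int F Mod wind_kernel F k)) \<le> B}"
proof (rule finite_subset)
  show "{k. card (carrier (wreath_int F Mod wind_kernel F k)) \<le> B} \<subseteq> {..B}"
  proof clarify
    fix k assume "card (carrier (wreath_int F Mod wind_kernel F k)) \<le> B"
    then have "2 ^ k \<le> B"
      using card_circular_wreath[of "2 ^ k"] by (simp add: card_wind_quotient nat_power_eq)
    then show "k \<le> B"
      using less_exp[of k] by linarith
  qed
qed simp

section \<open>The filtration by winding kernels\<close>

lemma mem_wind_kernel:
  "(x, n) \<in> wind_kernel F k \<longleftrightarrow> (x, n) \<in> carrier (wreath_int F) \<and> n mod 2 ^ k = 0 \<and>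
     (\<forall>r. gfinprod F x {i. i mod 2 ^ k = r mod 2 ^ k} = \<one>)"
  by (auto simp: wind_kernel_def kernel_def wind_def one_circular_wreath fun_eq_iff)

text \<open>A residue class modulo \<open>m\<close> is the disjoint union of the classes of
  \<open>r\<close> and \<open>r + m\<close> modulo \<open>2 * m\<close>, so its product is a product
  of two trivial factors.\<close>

lemma wind_kernel_Suc: "wind_kernel F (Suc k) \<subseteq> wind_kernel F k"
proof clarify
  fix x n assume "(x, n) \<in> wind_kernel F (Suc k)"
  then have xn: "(x, n) \<in> carrier (wreath_int F)" "n mod (2 * 2 ^ k) = 0"
    and x1: "\<And>r. gfinprod F x {i. i mod (2 * 2 ^ k) = r mod (2 * 2 ^ k)} = \<one>"
    by (auto simp: mem_wind_kernel)
  define m :: int where "m = 2 ^ k"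
  have m: "m > 0"
    by (simp add: m_def)
  have "gfinprod F x {i. i mod m = r mod m} = \<one>" for r
  proof -
    let ?A = "{i. i mod (2 * m) = r mod (2 * m)}" and ?B = "{i. i mod (2 * m) = (r + m) mod (2 * m)}"
    have "i mod m = r mod m \<longleftrightarrow> i \<in> ?A \<union> ?B" for i
    proof -
      have "i mod m = r mod m \<longleftrightarrow> (\<exists>q. i = r + m * q)"
        by (metis mod_eqE mod_mult_self2)
      also have "\<dots> \<longleftrightarrow> (\<exists>q. i = r + 2 * m * q) \<or> (\<exists>q. i = r + m + 2 * m * q)"
      proof
        assume "\<exists>q. i = r + m * q"
        then obtain q where q: "i = r + m * q"
          by blast
        show "(\<exists>q. i = r + 2 * m * q) \<or> (\<exists>q. i = r + m + 2 * m * q)"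
        proof (cases "even q")
          case True
          then show ?thesis
            using q by (auto elim!: evenE)
        next
          case False
          then show ?thesis
            using q by (auto elim!: oddE simp: algebra_simps)
        qed
      next
        assume "(\<exists>q. i = r + 2 * m * q) \<or> (\<exists>q. i = r + m + 2 * m * q)"
        then show "\<exists>q. i = r + m * q"
        proof (elim disjE exE)
          fix q assume "i = r + 2 * m * q"
          then show ?thesis
            by (intro exI[of _ "2 * q"]) simp
        next
          fix q assume "i = r + m + 2 * m * q"
          then show ?thesis
            by (intro exI[of _ "2 * q + 1"]) (simp add: algebra_simps)
        qed
      qed
      also have "\<dots> \<longleftrightarrow> i \<in> ?A \<union> ?B"
        by (auto simp: mod_mult_self2) (metis mod_eqE)+
      finally show ?thesis .
    qed
    then have "{i. i mod m = r mod m} = ?A \<union> ?B"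
      by blast
    moreover have "?A \<inter> ?B = {}"
    proof -
      have False if "r mod (2 * m) = (r + m) mod (2 * m)"
      proof -
        from mod_eqE[OF that[symmetric]] obtain q where "r = r + m + 2 * m * q"
          by metis
        \<comment> \<open>Impossible, since \<open>m\<close> is positive and
          \<open>1 + 2 * q\<close> is odd.\<close>
        then have "m * (1 + 2 * q) = 0"
          by (simp add: algebra_simps)
        with m show False
          by simp presburger
      qed
      then show ?thesis
        by auto
    qed
    moreover have "finite {i \<in> ?A \<union> ?B. x i \<noteq> \<one>}" "x \<in> ?A \<union> ?B \<rightarrow> carrier F"
      using xn(1) by (auto simp: carrier_wreath_int)
    ultimately have "gfinprod F x {i. i mod m = r mod m} = gfinprod F x ?A \<otimes> gfinprod F x ?B"
      by (simp only: gfinprod_Un_disjoint)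
    then show ?thesis
      using x1 by (simp add: m_def)
  qed
  moreover have "n mod m = 0"
    using xn(2) by (auto simp: m_def mod_eq_0_iff_dvd intro: dvd_trans)
  ultimately show "(x, n) \<in> wind_kernel F k"
    using xn(1) by (simp add: mem_wind_kernel m_def)
qed

text \<open>An integer divisible by all powers of 2 is 0. For a circle longer than the spread of the
  support, winding superposes no two lit lamps, so trivial products mean trivial lamps.\<close>

lemma Inter_wind_kernel: "(\<Inter>k. wind_kernel F k) = {\<one>\<^bsub>wreath_int F\<^esub>}"
proof
  have "\<one>\<^bsub>wreath_int F\<^esub> \<in> wind_kernel F k" for k
    using wind_kernel_normal by (meson normal_imp_subgroup subgroup.one_closed)
  then show "{\<one>\<^bsub>wreath_int F\<^esub>} \<subseteq> (\<Inter>k. wind_kernel F k)"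
    by blast
  show "(\<Inter>k. wind_kernel F k) \<subseteq> {\<one>\<^bsub>wreath_int F\<^esub>}"
  proof clarify
    fix x n assume "(x, n) \<in> (\<Inter>k. wind_kernel F k)"
    then have xn: "(x, n) \<in> carrier (wreath_int F)" "\<And>k. n mod 2 ^ k = 0"
      and x1: "\<And>k r. gfinprod F x {i. i mod 2 ^ k = r mod 2 ^ k} = \<one>"
      by (auto simp: mem_wind_kernel)
    have zero: "a = 0" if "\<bar>a\<bar> < 2 ^ k" "a mod 2 ^ k = 0" for a :: int and k
      using that zdvd_imp_le[of "2 ^ k" "\<bar>a\<bar>"] by (auto simp: mod_eq_0_iff_dvd)
    have large: "\<exists>k. a < 2 ^ k" for a :: int
    proof
      have "a \<le> int (nat a)"
        by simp
      also have "\<dots> < int (2 ^ nat a)"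
        using less_exp[of "nat a"] by (simp only: of_nat_less_iff)
      finally show "a < 2 ^ nat a"
        by simp
    qed
    obtain k where "\<bar>n\<bar> < 2 ^ k"
      using large by blast
    then have "n = 0"
      using zero xn(2) by blast
    moreover have "x j = \<one>" for j
    proof -
      \<comment> \<open>The position \<open>j\<close> is added because it may lie outside the
        support. Any two points of \<open>?I\<close> differ by at most \<open>2 * ?b\<close>, hence
        by less than the length of the circle chosen below.\<close>
      let ?I = "insert j {i. x i \<noteq> \<one>}"
      have fin: "finite ?I"
        using xn(1) by (simp add: carrier_wreath_int)
      let ?b = "\<Sum>i\<in>?I. \<bar>i\<bar>"
      obtain k where k: "2 * ?b < 2 ^ k"
        using large by blast
      have b: "\<bar>i\<bar> \<le> ?b" if "i \<in> ?I" for i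
        using that fin by (intro member_le_sum[where f = abs]) auto
      have "gfinprod F x {i. i mod 2 ^ k = j mod 2 ^ k} = x j"
      proof (rule gfinprod_singular)
        fix i assume i: "i \<in> {i. i mod 2 ^ k = j mod 2 ^ k}" "i \<noteq> j"
        show "x i = \<one>"
        proof (rule ccontr)
          assume "x i \<noteq> \<one>"
          then have "\<bar>i - j\<bar> < 2 ^ k"
            using b[of i] b[of j] k by auto
          moreover have "(i - j) mod 2 ^ k = 0"
            using i(1) by (simp add: mod_eq_dvd_iff mod_eq_0_iff_dvd)
          ultimately show False
            using zero i(2) by fastforce
        qed
      qed (use xn(1) in \<open>auto simp: carrier_wreath_int\<close>)
      then show ?thesis
        using x1 by simp
    qed
    ultimately show "(x, n) = \<one>\<^bsub>wreath_int F\<^esub>"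
      by (auto simp: one_wreath_int)
  qed
qed

lemma filtration_wind_kernel: "filtration (wreath_int F) (wind_kernel F)"
  unfolding filtration_def finite_index_subgroup_def
  using wind_kernel_normal wind_kernel_Suc Inter_wind_kernel finite_wind_quotient
  by (auto simp: FactGroup_def normal_imp_subgroup)

section \<open>Generators and edges of the Cayley graphs\<close>

lemma lamp_in_carrier [simp]: "f \<in> carrier F \<Longrightarrow> (lamp F j f, n) \<in> carrier (wreath_int F)"
  by (auto simp: carrier_wreath_int lamp_def)

text \<open>Conjugating by powers of the step moves the lamp at 0 to any position. Finite
  configurations are products of such lamps, and every element is a configuration followed by a
  shift.\<close>

lemma finite_generating_set_lamplighter_gens:
  "finite_generating_set (wreath_int F) (lamplighter_gens F)"
proof -
  let ?W = "wreath_int F"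
  let ?H = "generate ?W (lamplighter_gens F)"
  interpret W: group ?W
    by (rule group_wreath_int)
  have sub: "lamplighter_gens F \<subseteq> carrier ?W"
    by (auto simp: lamplighter_gens_def carrier_wreath_int lamp_def)
  interpret H: subgroup ?H ?W
    by (rule W.generate_is_subgroup[OF sub])
  have pos: "(\<lambda>_. \<one>, int n) \<in> ?H" for n
  proof (induction n)
    case 0
    show ?case
      using H.one_closed by (simp add: one_wreath_int)
  next
    case (Suc n)
    have "(\<lambda>_. \<one>, 1) \<in> ?H"
      by (rule generate.incl) (simp add: lamplighter_gens_def)
    from H.m_closed[OF Suc this] show ?case
      by (simp add: mult_wreath_int add.commute)
  qed
  have neg: "(\<lambda>_. \<one>, - int n) \<in> ?H" for n
  proof -
    have "inv\<^bsub>?W\<^esub> (\<lambda>_. \<one>, int n) = (\<lambda>_. \<one>, - int n)"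
      by (rule W.inv_equality) (simp_all add: mult_wreath_int one_wreath_int carrier_wreath_int)
    then show ?thesis
      using H.m_inv_closed[OF pos[of n]] by simp
  qed
  have shift: "(\<lambda>_. \<one>, n) \<in> ?H" for n
    using pos neg by (cases n rule: int_cases2) auto
  have lamp: "(lamp F j f, 0) \<in> ?H" if "f \<in> carrier F" for j f
  proof -
    have "(lamp F 0 f, 0) \<in> ?H"
      by (rule generate.incl) (simp add: lamplighter_gens_def that)
    then have "(\<lambda>_. \<one>, j) \<otimes>\<^bsub>?W\<^esub> (lamp F 0 f, 0) \<otimes>\<^bsub>?W\<^esub> (\<lambda>_. \<one>, - j) \<in> ?H"
      by (intro H.m_closed shift)
    moreover have "(\<lambda>_. \<one>, j) \<otimes>\<^bsub>?W\<^esub> (lamp F 0 f, 0) \<otimes>\<^bsub>?W\<^esub> (\<lambda>_. \<one>, - j) = (lamp F j f, 0)"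
      using that by (auto simp: mult_wreath_int lamp_def fun_eq_iff)
    ultimately show ?thesis
      by simp
  qed
  have config: "(x, 0) \<in> ?H" if "finite A" "\<forall>i. x i \<in> carrier F" "{i. x i \<noteq> \<one>} \<subseteq> A" for A x
    using that
  proof (induction A arbitrary: x)
    case empty
    then have "x = (\<lambda>_. \<one>)"
      by auto
    then show ?case
      using shift[of 0] by simp
  next
    case (insert j A)
    have "(x(j := \<one>), 0) \<in> ?H"
      by (rule insert.IH) (use insert.prems in auto)
    then have "(x(j := \<one>), 0) \<otimes>\<^bsub>?W\<^esub> (lamp F j (x j), 0) \<in> ?H"
      using insert.prems by (intro H.m_closed lamp) auto
    moreover have "(x(j := \<one>), 0) \<otimes>\<^bsub>?W\<^esub> (lamp F j (x j), 0) = (x, 0)"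
      using insert.prems by (auto simp: mult_wreath_int lamp_def fun_eq_iff)
    ultimately show ?case
      by simp
  qed
  have "carrier ?W \<subseteq> ?H"
  proof clarify
    fix x n assume xn: "(x, n) \<in> carrier ?W"
    then have "(x, 0) \<otimes>\<^bsub>?W\<^esub> (\<lambda>_. \<one>, n) \<in> ?H"
      by (intro H.m_closed shift config[of "{i. x i \<noteq> \<one>}"]) (auto simp: carrier_wreath_int)
    then show "(x, n) \<in> ?H"
      using xn by (simp add: mult_wreath_int carrier_wreath_int)
  qed
  moreover have "finite (lamplighter_gens F)"
    by (simp add: lamplighter_gens_def finite_lamps)
  ultimately show ?thesis
    using sub H.subset unfolding finite_generating_set_def by blast
qed

lemma wind_lamp:
  assumes "m > 0" "f \<in> carrier F"
  shows "wind F m (lamp F 0 f, 0) = (\<lambda>r. if r mod m = 0 then f else \<one>, 0)"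
proof -
  have "gfinprod F (lamp F 0 f) {i. i mod m = r mod m} = (if r mod m = 0 then f else \<one>)" for r
  proof (cases "r mod m = 0")
    case True
    then have "gfinprod F (lamp F 0 f) {i. i mod m = r mod m} = lamp F 0 f 0"
      using assms by (intro gfinprod_singular) (auto simp: lamp_def)
    then show ?thesis
      using True by (simp add: lamp_def)
  next
    case False
    then show ?thesis
      by (auto intro!: gfinprod_all_one simp: lamp_def)
  qed
  then show ?thesis
    by (simp add: wind_def)
qed

text \<open>The residue \<open>1 mod m\<close> accounts for the circle of length 1, where the step
  is trivial.\<close>

lemma wind_step: "wind F m (\<lambda>_. \<one>, 1) = (\<lambda>_. \<one>, 1 mod m)"
  by (simp add: wind_def gfinprod_all_one)

text \<open>The multiplication of \<open>F\<close> disappears from this description: edges only test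
  lamp states for equality. Hence the graph depends on \<open>carrier F\<close> only as a
  set.\<close>

lemma circular_edges:
  assumes m: "m > 0" and u: "(u, k) \<in> carrier (circular_wreath F m)"
    and v: "(v, l) \<in> carrier (circular_wreath F m)"
  shows "((u, k), (v, l)) \<in> cayley_edges (circular_wreath F m) (wind F m ` lamplighter_gens F) \<longleftrightarrow>
     (l = k \<and> (\<forall>r. r mod m \<noteq> k \<longrightarrow> u r = v r)) \<or>
     (u = v \<and> (l = (k + 1) mod m \<or> k = (l + 1) mod m))"
proof -
  have switch: "(\<exists>f\<in>carrier F. (v, l) = (u, k) \<otimes>\<^bsub>circular_wreath F m\<^esub> wind F m (lamp F 0 f, 0)) \<longleftrightarrow>
      l = k \<and> (\<forall>r. r mod m \<noteq> k \<longrightarrow> u r = v r)"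
    if "(u, k) \<in> carrier (circular_wreath F m)" "(v, l) \<in> carrier (circular_wreath F m)" for u k v l
  proof -
    have k: "k mod m = k"
      using that by (auto simp: carrier_circular_wreath)
    have uc: "\<And>i. u i \<in> carrier F" and vc: "\<And>i. v i \<in> carrier F"
      and up: "\<And>i. u (i mod m) = u i" and vp: "\<And>i. v (i mod m) = v i"
      using that by (auto simp: carrier_circular_wreath)
    \<comment> \<open>Right multiplication shifts the lamp generator by \<open>k\<close>, so it acts
      exactly where the lamplighter stands.\<close>
    have diff: "(r - k) mod m = 0 \<longleftrightarrow> r mod m = k" for r
      using k by (metis mod_eq_dvd_iff mod_eq_0_iff_dvd)
    show ?thesis
    proof
      assume "\<exists>f\<in>carrier F. (v, l) = (u, k) \<otimes>\<^bsub>circular_wreath F m\<^esub> wind F m (lamp F 0 f, 0)"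
      then show "l = k \<and> (\<forall>r. r mod m \<noteq> k \<longrightarrow> u r = v r)"
        using k uc by (auto simp: wind_lamp[OF m] mult_circular_wreath diff)
    next
      assume *: "l = k \<and> (\<forall>r. r mod m \<noteq> k \<longrightarrow> u r = v r)"
      \<comment> \<open>The element \<open>inv (u k) \<otimes> v k\<close> is the switch that
        changes the state \<open>u k\<close> into \<open>v k\<close>.\<close>
      have v_eq: "v r = u r \<otimes> (if r mod m = k then inv (u k) \<otimes> v k else \<one>)" for r
      proof (cases "r mod m = k")
        case True
        then have "u r = u k" "v r = v k"
          using up[of r] vp[of r] by auto
        then show ?thesis
          using True uc vc by (simp add: m_assoc[symmetric])
      qed (use * uc vc in auto)
      have "(u, k) \<otimes>\<^bsub>circular_wreath F m\<^esub> wind F m (lamp F 0 (inv (u k) \<otimes> v k), 0)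
          = (\<lambda>r. u r \<otimes> (if r mod m = k then inv (u k) \<otimes> v k else \<one>), k)"
        using k uc vc by (simp add: wind_lamp[OF m] mult_circular_wreath diff)
      also have "\<dots> = (v, l)"
        unfolding v_eq[symmetric] using * by simp
      finally have "(v, l) = (u, k) \<otimes>\<^bsub>circular_wreath F m\<^esub> wind F m (lamp F 0 (inv (u k) \<otimes> v k), 0)"
        by (rule sym)
      then show "\<exists>f\<in>carrier F. (v, l) = (u, k) \<otimes>\<^bsub>circular_wreath F m\<^esub> wind F m (lamp F 0 f, 0)"
        using uc vc by blast
    qed
  qed
  have step: "(v, l) = (u, k) \<otimes>\<^bsub>circular_wreath F m\<^esub> wind F m (\<lambda>_. \<one>, 1) \<longleftrightarrow>
      u = v \<and> l = (k + 1) mod m"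
    if "(u, k) \<in> carrier (circular_wreath F m)" for u k v l
    using that by (auto simp: wind_step mult_circular_wreath carrier_circular_wreath mod_add_right_eq)
  have "((u, k), (v, l)) \<in> cayley_edges (circular_wreath F m) (wind F m ` lamplighter_gens F) \<longleftrightarrow>
      (\<exists>f\<in>carrier F. (v, l) = (u, k) \<otimes>\<^bsub>circular_wreath F m\<^esub> wind F m (lamp F 0 f, 0)) \<or>
      (\<exists>f\<in>carrier F. (u, k) = (v, l) \<otimes>\<^bsub>circular_wreath F m\<^esub> wind F m (lamp F 0 f, 0)) \<or>
      (v, l) = (u, k) \<otimes>\<^bsub>circular_wreath F m\<^esub> wind F m (\<lambda>_. \<one>, 1) \<or>
      (u, k) = (v, l) \<otimes>\<^bsub>circular_wreath F m\<^esub> wind F m (\<lambda>_. \<one>, 1)"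
    using u v unfolding cayley_edges_def lamplighter_gens_def by blast
  then show ?thesis
    unfolding switch[OF u v] switch[OF v u] step[OF u] step[OF v] by auto
qed

text \<open>The isomorphism of the first isomorphism theorem sends the coset of a generator to its
  wound image, because \<open>wind\<close> is constant on cosets of its kernel.\<close>

lemma wind_quotient_cayley_iso:
  "cayley_iso (wreath_int F Mod wind_kernel F k)
     (image_in_quotient (wreath_int F) (wind_kernel F k) (lamplighter_gens F))
     (circular_wreath F (2 ^ k)) (wind F (2 ^ k) ` lamplighter_gens F)
     (\<lambda>X. the_elem (wind F (2 ^ k) ` X))"
proof -
  let ?h = "\<lambda>X. the_elem (wind F (2 ^ k) ` X)"
  interpret N: normal "wind_kernel F k" "wreath_int F"
    by (rule wind_kernel_normal)
  interpret h: group_hom "wreath_int F" "circular_wreath F (2 ^ k)" "wind F (2 ^ k)"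
    by (rule wind_group_hom) simp
  have gens: "lamplighter_gens F \<subseteq> carrier (wreath_int F)"
    using finite_generating_set_lamplighter_gens by (simp add: finite_generating_set_def)
  have "?h (wind_kernel F k #>\<^bsub>wreath_int F\<^esub> s) = wind F (2 ^ k) s"
    if s: "s \<in> carrier (wreath_int F)" for s
  proof -
    have "wind F (2 ^ k) y = wind F (2 ^ k) s" if y: "y \<in> wind_kernel F k #>\<^bsub>wreath_int F\<^esub> s" for y
    proof -
      obtain z where z: "z \<in> wind_kernel F k" "y = z \<otimes>\<^bsub>wreath_int F\<^esub> s"
        using y unfolding r_coset_def by blast
      then have "z \<in> carrier (wreath_int F)" "wind F (2 ^ k) z = \<one>\<^bsub>circular_wreath F (2 ^ k)\<^esub>"
        unfolding wind_kernel_def kernel_def by blast+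
      then show ?thesis
        using h.hom_mult[OF _ s] h.hom_closed[OF s] z(2) h.H.l_one by metis
    qed
    moreover have "wind_kernel F k #>\<^bsub>wreath_int F\<^esub> s \<noteq> {}"
      using N.rcos_self[OF s N.is_subgroup] by blast
    ultimately show ?thesis
      by (intro the_elem_image_unique)
  qed
  then have "?h ` image_in_quotient (wreath_int F) (wind_kernel F k) (lamplighter_gens F)
      = wind F (2 ^ k) ` lamplighter_gens F"
    unfolding image_image using gens by (intro image_cong) auto
  moreover have "image_in_quotient (wreath_int F) (wind_kernel F k) (lamplighter_gens F)
      \<subseteq> carrier (wreath_int F Mod wind_kernel F k)"
    unfolding carrier_FactGroup using gens by (rule image_mono)
  ultimately show ?thesis
    using cayley_iso_group_iso[OF wind_kernel_iso _ N.factorgroup_is_group] by metis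
qed

section \<open>Lamp pairs in finite index subgroups\<close>

text \<open>The lamps in state \<open>f\<close> at the infinitely many positions fall into finitely
  many cosets of \<open>A\<close>. Two in the same coset have their quotient in
  \<open>A\<close>.\<close>

lemma finite_index_lamp_pair:
  assumes A: "finite_index_subgroup A (wreath_int F)" and f: "f \<in> carrier F"
  shows "\<exists>i j. i \<noteq> j \<and> (\<lambda>k. lamp F i f k \<otimes> inv (lamp F j f k), 0) \<in> A"
proof -
  let ?W = "wreath_int F"
  interpret W: group ?W
    by (rule group_wreath_int)
  have sub: "subgroup A ?W" and fin: "finite (rcosets\<^bsub>?W\<^esub> A)"
    using A by (auto simp: finite_index_subgroup_def)
  let ?c = "\<lambda>i. A #>\<^bsub>?W\<^esub> (lamp F i f, 0)"
  have "range ?c \<subseteq> rcosets\<^bsub>?W\<^esub> A"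
    using lamp_in_carrier[OF f] unfolding RCOSETS_def by blast
  with fin have "finite (range ?c)"
    by (rule rev_finite_subset)
  then have "\<not> inj ?c"
    using finite_imageD infinite_UNIV_int by blast
  then obtain i j where ij: "i \<noteq> j" "?c i = ?c j"
    by (auto simp: inj_def)
  have "(lamp F i f, 0) \<in> ?c j"
    using W.rcos_self[OF _ sub, of "(lamp F i f, 0)"] f ij(2) by simp
  then have mem: "(lamp F i f, 0) \<otimes>\<^bsub>?W\<^esub> inv\<^bsub>?W\<^esub> (lamp F j f, 0) \<in> A"
    using subgroup.rcos_module_imp[OF sub] f by simp
  have "inv\<^bsub>?W\<^esub> (lamp F j f, 0) = (\<lambda>k. inv (lamp F j f k), 0)"
  proof (rule W.inv_equality)
    show "(\<lambda>k. inv (lamp F j f k), 0) \<in> carrier ?W"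
      using lamp_in_carrier[OF f, of j 0] by (simp add: carrier_wreath_int inv_eq_1_iff)
    show "(\<lambda>k. inv (lamp F j f k), 0) \<otimes>\<^bsub>?W\<^esub> (lamp F j f, 0) = \<one>\<^bsub>?W\<^esub>"
      using f by (auto simp: mult_wreath_int one_wreath_int lamp_def)
  qed (simp add: f)
  with mem ij(1) show ?thesis
    by (auto simp: mult_wreath_int)
qed

end

section \<open>Relabelling the lamp states\<close>

text \<open>Applying \<open>\<beta>\<close> to every lamp keeps positions and periodicity. By
  injectivity it also preserves and reflects equality of lamp states, which is all that edges
  test.\<close>

lemma circular_wreath_cayley_iso:
  assumes F: "lamp_group F" and F': "lamp_group F'" and m: "m > 0"
    and \<beta>: "bij_betw \<beta> (carrier F) (carrier F')"
  shows "cayley_iso (circular_wreath F m) (wind F m ` lamplighter_gens F)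
           (circular_wreath F' m) (wind F' m ` lamplighter_gens F') (map_prod ((\<circ>) \<beta>) id)"
  unfolding cayley_iso_def
proof (intro conjI ballI)
  let ?\<Phi> = "map_prod ((\<circ>) \<beta>) id :: (int \<Rightarrow> 'a) \<times> int \<Rightarrow> (int \<Rightarrow> 'c) \<times> int"
  let ?\<gamma> = "inv_into (carrier F) \<beta>"
  have \<beta>_mem: "\<beta> a \<in> carrier F'" if "a \<in> carrier F" for a
    using bij_betwE[OF \<beta>] that by blast
  have \<gamma>_mem: "?\<gamma> a \<in> carrier F" if "a \<in> carrier F'" for a
    using bij_betwE[OF bij_betw_inv_into[OF \<beta>]] that by blast
  have \<beta>_inj: "\<beta> a = \<beta> b \<longleftrightarrow> a = b" if "a \<in> carrier F" "b \<in> carrier F" for a b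
    using \<beta> that by (auto simp: bij_betw_def inj_on_def)
  have \<Phi>_mem: "?\<Phi> p \<in> carrier (circular_wreath F' m)" if "p \<in> carrier (circular_wreath F m)" for p
    using that \<beta>_mem by (cases p) (simp add: carrier_circular_wreath)
  show "bij_betw ?\<Phi> (carrier (circular_wreath F m)) (carrier (circular_wreath F' m))"
  proof (rule bij_betw_byWitness[where f' = "map_prod ((\<circ>) ?\<gamma>) id"])
    show "\<forall>p\<in>carrier (circular_wreath F m). map_prod ((\<circ>) ?\<gamma>) id (?\<Phi> p) = p"
      using bij_betw_inv_into_left[OF \<beta>] by (auto simp: carrier_circular_wreath fun_eq_iff)
    show "\<forall>p\<in>carrier (circular_wreath F' m). ?\<Phi> (map_prod ((\<circ>) ?\<gamma>) id p) = p"
      using bij_betw_inv_into_right[OF \<beta>] by (auto simp: carrier_circular_wreath fun_eq_iff)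
    show "?\<Phi> ` carrier (circular_wreath F m) \<subseteq> carrier (circular_wreath F' m)"
      by (rule image_subsetI) (rule \<Phi>_mem)
    show "map_prod ((\<circ>) ?\<gamma>) id ` carrier (circular_wreath F' m) \<subseteq> carrier (circular_wreath F m)"
    proof (rule image_subsetI)
      fix p assume "p \<in> carrier (circular_wreath F' m)"
      then show "map_prod ((\<circ>) ?\<gamma>) id p \<in> carrier (circular_wreath F m)"
        using \<gamma>_mem by (cases p) (simp add: carrier_circular_wreath)
    qed
  qed
  fix p q assume pq: "p \<in> carrier (circular_wreath F m)" "q \<in> carrier (circular_wreath F m)"
  obtain u k v l where eq: "p = (u, k)" "q = (v, l)"
    by (metis surj_pair)
  have "\<beta> (u i) = \<beta> (v i) \<longleftrightarrow> u i = v i" for i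
    using pq by (intro \<beta>_inj) (auto simp: eq carrier_circular_wreath)
  then show "(?\<Phi> p, ?\<Phi> q) \<in> cayley_edges (circular_wreath F' m) (wind F' m ` lamplighter_gens F') \<longleftrightarrow>
      (p, q) \<in> cayley_edges (circular_wreath F m) (wind F m ` lamplighter_gens F)"
    using \<Phi>_mem[OF pq(1)] \<Phi>_mem[OF pq(2)] pq
    by (simp add: eq lamp_group.circular_edges[OF F m] lamp_group.circular_edges[OF F' m] fun_eq_iff)
qed

text \<open>Pass to the circle over \<open>F\<close>, relabel the lamps by a fixed bijection, and
  return to the quotient over \<open>F'\<close>.\<close>

lemma wind_quotients_cayley_iso:
  assumes F: "lamp_group F" and F': "lamp_group F'" and card: "card (carrier F) = card (carrier F')"
  obtains f where "\<And>k. cayley_iso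
      (wreath_int F Mod wind_kernel F k)
      (image_in_quotient (wreath_int F) (wind_kernel F k) (lamplighter_gens F))
      (wreath_int F' Mod wind_kernel F' k)
      (image_in_quotient (wreath_int F') (wind_kernel F' k) (lamplighter_gens F')) (f k)"
proof -
  obtain \<beta> where \<beta>: "bij_betw \<beta> (carrier F) (carrier F')"
    using finite_same_card_bij lamp_group.finite_lamps[OF F] lamp_group.finite_lamps[OF F'] card
    by blast
  have pow: "(0::int) < 2 ^ k" for k
    by simp
  show thesis
    using cayley_iso_comp[OF cayley_iso_comp[OF lamp_group.wind_quotient_cayley_iso[OF F]
          circular_wreath_cayley_iso[OF F F' pow \<beta>]]
        cayley_iso_inv[OF lamp_group.wind_quotient_cayley_iso[OF F']]]
    by (rule that)
qed



section \<open>An obstruction to commensurability from torsion\<close>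

text \<open>Every finite index subgroup on the side of \<open>F\<close> contains an element of order
  4 made of two lamps. Its image would be a torsion element on the side of \<open>F'\<close>, hence
  a pure configuration whose square is trivial.\<close>

lemma not_commensurable_wreath_int:
  assumes F: "lamp_group F" and F': "lamp_group F'"
    and f: "f \<in> carrier F" "f \<otimes>\<^bsub>F\<^esub> f \<noteq> \<one>\<^bsub>F\<^esub>" "(f \<otimes>\<^bsub>F\<^esub> f) \<otimes>\<^bsub>F\<^esub> (f \<otimes>\<^bsub>F\<^esub> f) = \<one>\<^bsub>F\<^esub>"
    and exp2: "\<And>a. a \<in> carrier F' \<Longrightarrow> a \<otimes>\<^bsub>F'\<^esub> a = \<one>\<^bsub>F'\<^esub>"
  shows "\<not> commensurable (wreath_int F) (wreath_int F')"
proof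
  interpret F: lamp_group F by (rule F)
  interpret F': lamp_group F' by (rule F')
  let ?W = "wreath_int F" and ?W' = "wreath_int F'"
  interpret W: group ?W by (rule F.group_wreath_int)
  interpret W': group ?W' by (rule F'.group_wreath_int)
  assume "commensurable ?W ?W'"
  then obtain A B \<phi> where A: "finite_index_subgroup A ?W" and B: "finite_index_subgroup B ?W'"
    and \<phi>: "\<phi> \<in> iso (?W\<lparr>carrier := A\<rparr>) (?W'\<lparr>carrier := B\<rparr>)"
    by (auto simp: commensurable_def is_iso_def)
  interpret A: subgroup A ?W
    using A by (simp add: finite_index_subgroup_def)
  interpret B: subgroup B ?W'
    using B by (simp add: finite_index_subgroup_def)
  obtain i j where ij: "i \<noteq> j" "(\<lambda>k. lamp F i f k \<otimes>\<^bsub>F\<^esub> inv\<^bsub>F\<^esub> (lamp F j f k), 0) \<in> A"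
    using F.finite_index_lamp_pair[OF A f(1)] by blast
  define x where "x = (\<lambda>k. lamp F i f k \<otimes>\<^bsub>F\<^esub> inv\<^bsub>F\<^esub> (lamp F j f k))"
  define g where "g = (x, 0::int)"
  have g: "g \<in> A"
    using ij by (simp add: g_def x_def)
  \<comment> \<open>Needed at position \<open>j\<close>, where the lamp of \<open>x\<close> is the
    inverse of \<open>f\<close>.\<close>
  have finv: "(inv\<^bsub>F\<^esub> f \<otimes>\<^bsub>F\<^esub> inv\<^bsub>F\<^esub> f) \<otimes>\<^bsub>F\<^esub> (inv\<^bsub>F\<^esub> f \<otimes>\<^bsub>F\<^esub> inv\<^bsub>F\<^esub> f) = \<one>\<^bsub>F\<^esub>"
    using f(1,3) by (simp add: F.inv_mult_group[symmetric])
  have gg: "g \<otimes>\<^bsub>?W\<^esub> g = (\<lambda>k. x k \<otimes>\<^bsub>F\<^esub> x k, 0)"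
    by (simp add: g_def mult_wreath_int)
  \<comment> \<open>As \<open>i\<close> and \<open>j\<close> differ, the second lamp does not
    interfere and \<open>x i\<close> is \<open>f\<close>.\<close>
  have "x i \<otimes>\<^bsub>F\<^esub> x i \<noteq> \<one>\<^bsub>F\<^esub>"
    using f(1,2) ij(1) by (simp add: x_def lamp_def)
  then have gg_neq: "g \<otimes>\<^bsub>?W\<^esub> g \<noteq> \<one>\<^bsub>?W\<^esub>"
    unfolding gg one_wreath_int by (auto simp: fun_eq_iff)
  have "(x k \<otimes>\<^bsub>F\<^esub> x k) \<otimes>\<^bsub>F\<^esub> (x k \<otimes>\<^bsub>F\<^esub> x k) = \<one>\<^bsub>F\<^esub>" for k
    using f(1,3) finv ij(1) by (auto simp: x_def lamp_def)
  then have gggg: "(g \<otimes>\<^bsub>?W\<^esub> g) \<otimes>\<^bsub>?W\<^esub> (g \<otimes>\<^bsub>?W\<^esub> g) = \<one>\<^bsub>?W\<^esub>"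
    unfolding gg by (simp add: mult_wreath_int one_wreath_int)
  have hom: "\<phi> (a \<otimes>\<^bsub>?W\<^esub> b) = \<phi> a \<otimes>\<^bsub>?W'\<^esub> \<phi> b" if "a \<in> A" "b \<in> A" for a b
    using \<phi> that by (auto simp: iso_def hom_def)
  have one: "\<phi> \<one>\<^bsub>?W\<^esub> = \<one>\<^bsub>?W'\<^esub>"
    using hom_one[of \<phi> "?W\<lparr>carrier := A\<rparr>" "?W'\<lparr>carrier := B\<rparr>"] \<phi>
      W.subgroup_imp_group[OF A.subgroup_axioms] W'.subgroup_imp_group[OF B.subgroup_axioms]
    by (simp add: iso_def)
  obtain y n where h: "\<phi> g = (y, n)"
    by (metis surj_pair)
  have "\<phi> g \<in> carrier ?W'"
    using \<phi> g B.subset by (auto simp: iso_def hom_def)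
  then have y: "\<And>k. y k \<in> carrier F'"
    by (simp add: h F'.carrier_wreath_int)
  have "(\<phi> g \<otimes>\<^bsub>?W'\<^esub> \<phi> g) \<otimes>\<^bsub>?W'\<^esub> (\<phi> g \<otimes>\<^bsub>?W'\<^esub> \<phi> g) = \<one>\<^bsub>?W'\<^esub>"
    using hom g gggg one A.m_closed by metis
  \<comment> \<open>The fourth power has position \<open>4 * n\<close>, and the integers are torsion
    free.\<close>
  then have "n = 0"
    by (simp add: h mult_wreath_int one_wreath_int)
  then have "\<phi> g \<otimes>\<^bsub>?W'\<^esub> \<phi> g = \<one>\<^bsub>?W'\<^esub>"
    using y by (simp add: h mult_wreath_int one_wreath_int exp2)
  then have "\<phi> (g \<otimes>\<^bsub>?W\<^esub> g) = \<phi> \<one>\<^bsub>?W\<^esub>"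
    using hom g one by simp
  moreover have "inj_on \<phi> A"
    using \<phi> by (auto simp: iso_def bij_betw_def)
  ultimately show False
    using gg_neq g A.m_closed A.one_closed by (metis inj_onD)
qed

section \<open>The lamp groups of order 4\<close>

text \<open>Since a box space is defined only up to coarse equivalence, that relation is proved for
  all generating sets and box metrics over the two filtrations. Isometry depends on these choices
  and is shown for one of them.\<close>

theorem proposition10:
  shows "\<not> commensurable
           (wreath_int (integer_mod_group 4))
           (wreath_int (integer_mod_group 2 \<times>\<times> integer_mod_group 2)) \<and>
         (\<exists>M N.
           filtration (wreath_int (integer_mod_group 4)) M \<and>
           filtration (wreath_int (integer_mod_group 2 \<times>\<times> integer_mod_group 2)) N \<and>
           (\<forall>S T X Y.
              box_space (wreath_int (integer_mod_group 4)) S M X \<longrightarrow>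
              box_space (wreath_int (integer_mod_group 2 \<times>\<times> integer_mod_group 2)) T N Y \<longrightarrow>
              coarsely_equivalent X Y) \<and>
           (\<exists>S T X Y.
              box_space (wreath_int (integer_mod_group 4)) S M X \<and>
              box_space (wreath_int (integer_mod_group 2 \<times>\<times> integer_mod_group 2)) T N Y \<and>
              isometric X Y))"
proof
  let ?F = "integer_mod_group 4" and ?F' = "integer_mod_group 2 \<times>\<times> integer_mod_group 2"
  have F: "lamp_group ?F"
    by (simp add: lamp_group_def lamp_group_axioms_def carrier_integer_mod_group)
  have F': "lamp_group ?F'"
  proof -
    have "comm_group ?F'"
      by (rule group.group_comm_groupI[OF DirProd_group]) (auto simp: add.commute)
    then show ?thesis
      by (simp add: lamp_group_def lamp_group_axioms_def carrier_integer_mod_group)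
  qed
  show "\<not> commensurable (wreath_int ?F) (wreath_int ?F')"
  \<comment> \<open>The residue \<open>1\<close> is an element of order 4.\<close>
  proof (rule not_commensurable_wreath_int[OF F F', of 1])
    fix a assume "a \<in> carrier ?F'"
    then show "a \<otimes>\<^bsub>?F'\<^esub> a = \<one>\<^bsub>?F'\<^esub>"
      \<comment> \<open>Each coordinate of the square is twice a residue modulo 2, hence 0;
        \<open>mult_2\<close> is reversed to make the factor 2 visible.\<close>
      by (cases a) (simp add: mult_2[symmetric] del: mult_2)
  qed simp_all
  have "card (carrier ?F) = card (carrier ?F')"
    by (simp add: carrier_integer_mod_group DirProd_def card_cartesian_product)
  then obtain f where f: "\<And>k. cayley_iso
      (wreath_int ?F Mod wind_kernel ?F k)
      (image_in_quotient (wreath_int ?F) (wind_kernel ?F k) (lamplighter_gens ?F))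
      (wreath_int ?F' Mod wind_kernel ?F' k)
      (image_in_quotient (wreath_int ?F') (wind_kernel ?F' k) (lamplighter_gens ?F')) (f k)"
    using wind_quotients_cayley_iso[OF F F'] by blast
  note gens = lamp_group.finite_generating_set_lamplighter_gens[OF F]
    lamp_group.finite_generating_set_lamplighter_gens[OF F']
  note filt = lamp_group.filtration_wind_kernel[OF F] lamp_group.filtration_wind_kernel[OF F']
  let ?M = "wind_kernel ?F" and ?N = "wind_kernel ?F'"
  have "coarsely_equivalent X Y"
    if "box_space (wreath_int ?F) S ?M X" "box_space (wreath_int ?F') T ?N Y" for S T X Y
    using coarsely_equivalent_box_spaces[OF that gens lamp_group.wind_quotient_growth[OF F] f] .
  moreover have "box_space (wreath_int ?F) (lamplighter_gens ?F) ?M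
      (box_metric (wreath_int ?F) (lamplighter_gens ?F) ?M)"
    by (rule box_space_box_metric[OF gens(1) filt(1)])
  moreover have "box_space (wreath_int ?F') (lamplighter_gens ?F') ?N
      (box_metric (wreath_int ?F') (lamplighter_gens ?F') ?N)"
    by (rule box_space_box_metric[OF gens(2) filt(2)])
  moreover have "isometric (box_metric (wreath_int ?F) (lamplighter_gens ?F) ?M)
      (box_metric (wreath_int ?F') (lamplighter_gens ?F') ?N)"
    by (rule isometric_box_metric[OF gens(1) filt(1) gens(2) filt(2) f])
  ultimately show "\<exists>M N. filtration (wreath_int ?F) M \<and> filtration (wreath_int ?F') N \<and>
      (\<forall>S T X Y. box_space (wreath_int ?F) S M X \<longrightarrow> box_space (wreath_int ?F') T N Y \<longrightarrow>
         coarsely_equivalent X Y) \<and>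
      (\<exists>S T X Y. box_space (wreath_int ?F) S M X \<and> box_space (wreath_int ?F') T N Y \<and>
         isometric X Y)"
    using filt by (intro exI[of _ ?M] exI[of _ ?N]) blast
qed

end
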